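(* Let $Q_{n,k}=\sum_{j=0}^nQ_{n,k,j}$. Using the $h$-basis to partially order the ring of symmetric functions: (1) for all $n,k,j\ge0$, $Q_{n,k,j}$ is an $h$-positive symmetric function; (2) for all $n\ge1$ and $0\le j\le n$, the polynomial $\sum_{k=0}^{ln-1}Q_{n,k,j}t^k$ is $t$-symmetric and $t$-unimodal with center of symmetry $\frac{l(n-j)}{2}$; (3) for all $n\ge1$, the polynomial $\sum_{k=0}^{ln-1}Q_{n,k}t^k$ is $t$-symmetric and $t$-unimodal with center of symmetry $\frac{ln-1}{2}$.
   Context: Fix $l\ge1$ and indeterminates $x_1,x_2,\dots$. $\mathcal{B}$ is the alphabet of letters $u^m$ ($u\ge1$, $0\le m\le l-1$; $m$-colored) and barred letters $\overline{u^0}$ ($u\ge1$; $0$-colored), each with absolute value $u$ and weight $x_u$. A colored necklace is a primitive circular word over $\mathcal{B}$ (read clockwise, up to rotation) such that every barred letter is followed by a letter of lesser or equal absolute value, every $0$-colored unbarred letter is followed by a letter of greater or equal absolute value, and no necklace of length one is a single barred letter. A colored ornament is a finite multiset of colored necklaces, with weight the product of the weights of its letters. $Q_{n,k,j}$ is the sum of the weights of all colored ornaments with $n$ letters, exactly $j$ necklaces consisting of a single letter $u^0$, and $l\cdot(\#\text{barred letters})+\sum_{m=1}^{l-1}m\cdot(\#\text{letters }u^m)=k$ (this coincides with the paper's flag Eulerian quasisymmetric functions by Hyatt's colored ornament interpretation). A symmetric function is $h$-positive if it is a nonnegative linear combination of the $h_\lambda=h_{\lambda_1}h_{\lambda_2}\cdots$;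 $f\le_h g$ means $g-f$ is $h$-positive. A nonzero polynomial $\sum_{i=r}^sa_it^i$ ($a_r,a_s\ne0$) with coefficients symmetric functions is $t$-symmetric with center $\frac{r+s}{2}$ if $a_{r+k}=a_{s-k}$ for all $k$, and $t$-unimodal if $a_r\le_h a_{r+1}\le_h\cdots\le_h a_{\lfloor (r+s)/2\rfloor}$ and $a_{\lfloor (r+s+1)/2\rfloor}\ge_h\cdots\ge_h a_s$.
   Formalization: Part (2) is stated for those n and j for which the polynomial is nonzero, since t-symmetry and t-unimodality are defined only for nonzero polynomials; for l=1 and j=n-1 the polynomial is zero. *)

theory Defs
  imports Complex_Main "HOL-Library.Multiset"
begin

text \<open>Let u m is the m-colored letter u^m; Bar u is the barred (0-colored) letter.\<close>
datatype letter = Let nat nat | Bar nat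

fun absv :: "letter \<Rightarrow> nat" where
  "absv (Let u m) = u"
| "absv (Bar u) = u"

fun valid_letter :: "nat \<Rightarrow> letter \<Rightarrow> bool" where
  "valid_letter l (Let u m) = (1 \<le> u \<and> m < l)"
| "valid_letter l (Bar u) = (1 \<le> u)"

definition follow_ok :: "letter \<Rightarrow> letter \<Rightarrow> bool" where
  "follow_ok x y \<longleftrightarrow>
     (\<forall>u. x = Bar u \<longrightarrow> absv y \<le> u) \<and> (\<forall>u. x = Let u 0 \<longrightarrow> u \<le> absv y)"

definition primitive_word :: "'a list \<Rightarrow> bool" where
  "primitive_word w \<longleftrightarrow> w \<noteq> [] \<and>
     \<not> (\<exists>v k. 2 \<le> k \<and> w = concat (replicate k v))"

definition necklace_word :: "nat \<Rightarrow> letter list \<Rightarrow> bool" where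
  "necklace_word l w \<longleftrightarrow> primitive_word w \<and> (\<forall>x\<in>set w. valid_letter l x)
     \<and> (\<forall>i<length w. follow_ok (w ! i) (w ! ((i + 1) mod length w)))
     \<and> (\<forall>u. w \<noteq> [Bar u])"

definition necklace :: "nat \<Rightarrow> letter list set \<Rightarrow> bool" where
  "necklace l N \<longleftrightarrow> (\<exists>w. necklace_word l w \<and> N = range (\<lambda>i. rotate i w))"

definition nword :: "letter list set \<Rightarrow> letter list" where
  "nword N = (SOME w. w \<in> N)"

definition letter_stat :: "nat \<Rightarrow> letter \<Rightarrow> nat" where
  "letter_stat l x = (case x of Bar u \<Rightarrow> l | Let u m \<Rightarrow> m)"

type_synonym ornament = "letter list set multiset"

definition orn_letters :: "ornament \<Rightarrow> letter multiset" where
  "orn_letters Or = (\<Sum>N\<in>#Or. mset (nword N))"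

definition orn_content :: "ornament \<Rightarrow> nat \<Rightarrow> nat" where
  "orn_content Or u = count (image_mset absv (orn_letters Or)) u"

definition orn_stat :: "nat \<Rightarrow> ornament \<Rightarrow> nat" where
  "orn_stat l Or = (\<Sum>x\<in>#orn_letters Or. letter_stat l x)"

definition orn_singles :: "ornament \<Rightarrow> nat" where
  "orn_singles Or = size (filter_mset (\<lambda>N. \<exists>u. N = {[Let u 0]}) Or)"

text \<open>A (formal power series) function in x_1, x_2, ... is represented by its coefficient
  function on exponent vectors alpha :: nat => nat (alpha u = exponent of x_u).\<close>
type_synonym sf = "(nat \<Rightarrow> nat) \<Rightarrow> int"

definition Q :: "nat \<Rightarrow> nat \<Rightarrow> nat \<Rightarrow> nat \<Rightarrow> sf" where
  "Q l n k j = (\<lambda>\<alpha>. int (card {Or :: ornament. (\<forall>N\<in>#Or. necklace l N)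
        \<and> size (orn_letters Or) = n \<and> orn_stat l Or = k \<and> orn_singles Or = j
        \<and> orn_content Or = \<alpha>}))"

definition Qsum :: "nat \<Rightarrow> nat \<Rightarrow> nat \<Rightarrow> sf" where
  "Qsum l n k = (\<lambda>\<alpha>. \<Sum>j\<le>n. Q l n k j \<alpha>)"

definition hfun :: "nat \<Rightarrow> sf" where
  "hfun p = (\<lambda>\<alpha>. if \<alpha> 0 = 0 \<and> finite {u. \<alpha> u \<noteq> 0} \<and> (\<Sum>u\<in>{u. \<alpha> u \<noteq> 0}. \<alpha> u) = p
                  then 1 else 0)"

definition sf_mult :: "sf \<Rightarrow> sf \<Rightarrow> sf" where
  "sf_mult f g = (\<lambda>\<alpha>. \<Sum>\<beta>\<in>{\<beta>. \<forall>u. \<beta> u \<le> \<alpha> u}. f \<beta> * g (\<lambda>u. \<alpha> u - \<beta> u))"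

definition sf_one :: sf where
  "sf_one = (\<lambda>\<alpha>. if \<alpha> = (\<lambda>_. 0) then 1 else 0)"

definition h_part :: "nat list \<Rightarrow> sf" where
  "h_part lam = foldr (\<lambda>p acc. sf_mult (hfun p) acc) lam sf_one"

definition is_partition :: "nat list \<Rightarrow> bool" where
  "is_partition lam \<longleftrightarrow> sorted_wrt (\<ge>) lam \<and> (\<forall>p\<in>set lam. 0 < p)"

definition h_positive :: "sf \<Rightarrow> bool" where
  "h_positive f \<longleftrightarrow> (\<exists>S c. finite S \<and> (\<forall>lam\<in>S. is_partition lam) \<and> (\<forall>lam. 0 \<le> (c lam :: int))
       \<and> f = (\<lambda>\<alpha>. \<Sum>lam\<in>S. c lam * h_part lam \<alpha>))"

definition h_le :: "sf \<Rightarrow> sf \<Rightarrow> bool" where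
  "h_le f g \<longleftrightarrow> h_positive (\<lambda>\<alpha>. g \<alpha> - f \<alpha>)"

text \<open>A polynomial sum a_k t^k is given by its coefficient sequence a (finitely supported).
  poly_bounds a r s: a is nonzero with lowest nonzero index r and highest s.\<close>
definition poly_bounds :: "(nat \<Rightarrow> sf) \<Rightarrow> nat \<Rightarrow> nat \<Rightarrow> bool" where
  "poly_bounds a r s \<longleftrightarrow> r \<le> s \<and> a r \<noteq> (\<lambda>_. 0) \<and> a s \<noteq> (\<lambda>_. 0)
      \<and> (\<forall>k. k < r \<or> s < k \<longrightarrow> a k = (\<lambda>_. 0))"

definition t_symmetric :: "(nat \<Rightarrow> sf) \<Rightarrow> real \<Rightarrow> bool" where
  "t_symmetric a c \<longleftrightarrow> (\<exists>r s. poly_bounds a r s \<and> (\<forall>i\<le>s - r. a (r + i) = a (s - i))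
      \<and> c = real (r + s) / 2)"

definition t_unimodal :: "(nat \<Rightarrow> sf) \<Rightarrow> bool" where
  "t_unimodal a \<longleftrightarrow> (\<exists>r s. poly_bounds a r s
      \<and> (\<forall>i. r \<le> i \<and> i < (r + s) div 2 \<longrightarrow> h_le (a i) (a (i + 1)))
      \<and> (\<forall>i. (r + s + 1) div 2 \<le> i \<and> i < s \<longrightarrow> h_le (a (i + 1)) (a i)))"

end

theory Submission
  imports Defs "HOL-Computational_Algebra.Polynomial" "HOL-Library.List_Lexorder"
    "HOL-Library.Product_Lexorder"
begin

text \<open>Order the letters by decreasing absolute value, barred letters first within an absolute value.
  Then the nonincreasing factorization into Lyndon words identifies ornaments with banners, that is
  with linear words that satisfy the adjacency conditions and do not end in a barred letter.
  Splitting banners by their first letter determines their generating function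
  \<open>T = (1 - t) H(z) / (H(t\<^sup>lz) - t H(z))\<close>, where \<open>H(z) = \<Sum> h\<^sub>n z\<^sup>n\<close>. Removing the necklaces
  \<open>u\<^sup>0\<close> gives \<open>T = H D\<close> with \<open>D = \<Sum> Q\<^sub>n\<^sub>,\<^sub>k\<^sub>,\<^sub>0 t\<^sup>k z\<^sup>n\<close>, and \<open>Q\<^sub>n\<^sub>,\<^sub>k\<^sub>,\<^sub>j = h\<^sub>j Q\<^sub>n\<^sub>-\<^sub>j\<^sub>,\<^sub>k\<^sub>,\<^sub>0\<close>. Therefore
  \<open>D = 1 + (\<Sum> (t + \<dots> + t\<^sup>l\<^sup>n\<^sup>-\<^sup>1) h\<^sub>n z\<^sup>n) D\<close> and \<open>T = 1 + (\<Sum> (1 + \<dots> + t\<^sup>l\<^sup>n\<^sup>-\<^sup>1) h\<^sub>n z\<^sup>n) D\<close>, and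
  products of symmetric unimodal polynomials in \<open>t\<close> are symmetric and unimodal with added centers.\<close>

section \<open>Power series in commuting variables\<close>

text \<open>There are infinitely many variables, so the telescoping runs only over the absolute
  values up to n; on a fixed monomial the restricted series become stationary as n grows, and the
  identity for T is read off there. Positivity comes from a divisibility:
  \<open>H(t\<^sup>lz) - t H(z)\<close> is \<open>1 - t\<close> times a series with constant term 1
  in which each \<open>h\<^sub>n\<close>, n \<ge> 1, carries a negative interval of powers of t, so
  the reciprocal expands with positive intervals only. The interval for D runs from t to
  \<open>t\<^sup>l\<^sup>n\<^sup>-\<^sup>1\<close> and has center ln/2, hence the centers in a
  product add up to a number that depends on the degree alone. Each product occurring in T has
  exactly one factor whose interval starts at 1 instead of t; this moves the center to (ln -
  1)/2.\<close>

text \<open>A monomial is encoded as the multiset of the indices of its variables.\<close>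

typedef 'a mser = "UNIV :: (nat multiset \<Rightarrow> 'a) set" morphisms mcoeff Abs_mser ..

setup_lifting type_definition_mser

lemma mser_eqI: "(\<And>M. mcoeff F M = mcoeff G M) \<Longrightarrow> F = G"
  by (metis mcoeff_inject ext)

lemma finite_submultisets [simp]: "finite {A. A \<subseteq># M}"
proof (induction M)
  case (add x M)
  have "A \<in> {A. A \<subseteq># M} \<union> add_mset x ` {A. A \<subseteq># M}" if "A \<subseteq># add_mset x M" for A
  proof (cases "x \<in># A")
    case True
    then obtain B where "A = add_mset x B" by (metis insert_DiffM)
    with that show ?thesis by auto
  next
    case False
    then have "A \<subseteq># M"
      using that by (metis Diff_eq_empty_iff_mset diff_add_mset_swap add_mset_diff_bothsides
          add_mset_remove_trivial diff_single_trivial subset_eq_diff_conv union_single_eq_diff add_mset_add_single)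
    then show ?thesis by simp
  qed
  then have "{A. A \<subseteq># add_mset x M} \<subseteq> {A. A \<subseteq># M} \<union> add_mset x ` {A. A \<subseteq># M}"
    by blast
  with add show ?case by (meson finite_UnI finite_imageI finite_subset)
qed simp

instantiation mser :: (comm_ring_1) comm_ring_1
begin

lift_definition zero_mser :: "'a mser" is "\<lambda>_. 0" .
lift_definition one_mser :: "'a mser" is "\<lambda>M. if M = {#} then 1 else 0" .
lift_definition plus_mser :: "'a mser \<Rightarrow> 'a mser \<Rightarrow> 'a mser" is "\<lambda>F G M. F M + G M" .
lift_definition minus_mser :: "'a mser \<Rightarrow> 'a mser \<Rightarrow> 'a mser" is "\<lambda>F G M. F M - G M" .
lift_definition uminus_mser :: "'a mser \<Rightarrow> 'a mser" is "\<lambda>F M. - F M" .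
lift_definition times_mser :: "'a mser \<Rightarrow> 'a mser \<Rightarrow> 'a mser"
  is "\<lambda>F G M. \<Sum>A | A \<subseteq># M. F A * G (M - A)" .

instance
proof
  fix F G K :: "'a mser"
  show "F * G * K = F * (G * K)"
  proof (rule mser_eqI)
    fix M
    let ?f = "\<lambda>A B. mcoeff F A * mcoeff G B * mcoeff K (M - A - B)"
    have "mcoeff (F * G * K) M
        = (\<Sum>C | C \<subseteq># M. \<Sum>A | A \<subseteq># C. mcoeff F A * mcoeff G (C - A) * mcoeff K (M - C))"
      by (simp add: times_mser.rep_eq sum_distrib_right)
    also have "\<dots> = (\<Sum>(C, A) \<in> (SIGMA C:{C. C \<subseteq># M}. {A. A \<subseteq># C}).
        mcoeff F A * mcoeff G (C - A) * mcoeff K (M - C))"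
      by (subst sum.Sigma) auto
    also have "\<dots> = (\<Sum>(A, B) \<in> (SIGMA A:{A. A \<subseteq># M}. {B. B \<subseteq># M - A}). ?f A B)"
    proof (rule sum.reindex_bij_witness[where i = "\<lambda>(A, B). (A + B, A)" and j = "\<lambda>(C, A). (A, C - A)"];
        clarsimp simp del: diff_diff_add_mset)
      fix C A assume "A \<subseteq># C" "C \<subseteq># M"
      then show "A \<subseteq># M \<and> C - A \<subseteq># M - A"
        by (metis subset_mset.diff_add subset_mset.le_diff_conv2 subset_mset.trans)
    next
      fix A B assume "A \<subseteq># M" "B \<subseteq># M - A"
      then show "A + B \<subseteq># M"
        by (simp add: subset_mset.le_diff_conv2 add.commute)
    next
      fix C A assume "A \<subseteq># C" "C \<subseteq># M"
      then show "mcoeff F A * mcoeff G (C - A) * mcoeff K (M - A - (C - A)) = mcoeff F A * mcoeff G (C - A) * mcoeff K (M - C)"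
        by simp
    qed
    also have "\<dots> = mcoeff (F * (G * K)) M"
      by (subst sum.Sigma[symmetric]) (auto simp: times_mser.rep_eq sum_distrib_left mult.assoc)
    finally show "mcoeff (F * G * K) M = mcoeff (F * (G * K)) M" .
  qed
  show "F * G = G * F"
  proof (rule mser_eqI)
    fix M :: "nat multiset"
    have dd: "M - (M - A) = A" if "A \<subseteq># M" for A
      using that by (simp add: multiset_eq_iff subseteq_mset_def)
    show "mcoeff (F * G) M = mcoeff (G * F) M"
      unfolding times_mser.rep_eq
      by (rule sum.reindex_bij_witness[where i = "\<lambda>A. M - A" and j = "\<lambda>A. M - A"])
         (simp_all add: mult.commute dd)
  qed
  show "1 * F = F"
  proof (rule mser_eqI)
    fix M
    have "mcoeff (1 * F) M = (\<Sum>A | A \<subseteq># M. if A = {#} then mcoeff F (M - A) else 0)"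
      unfolding times_mser.rep_eq one_mser.rep_eq by (rule sum.cong) auto
    then show "mcoeff (1 * F) M = mcoeff F M" by (simp add: sum.delta)
  qed
  show "(F + G) * K = F * K + G * K"
    by (rule mser_eqI) (simp add: times_mser.rep_eq plus_mser.rep_eq distrib_right sum.distrib)
  show "(0 :: 'a mser) \<noteq> 1"
    by transfer (metis zero_neq_one)
qed (rule mser_eqI, simp add: plus_mser.rep_eq minus_mser.rep_eq uminus_mser.rep_eq
    zero_mser.rep_eq algebra_simps)+

end

lemmas mser_simps = zero_mser.rep_eq one_mser.rep_eq plus_mser.rep_eq minus_mser.rep_eq uminus_mser.rep_eq

lemma mcoeff_sum: "mcoeff (sum f A) M = (\<Sum>a\<in>A. mcoeff (f a) M)"
  by (induction A rule: infinite_finite_induct) (auto simp: mser_simps)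

text \<open>In the applications the coefficient ring is Z[t]: t is a scalar and not one of the
  variables, so polynomials in t act through constant series.\<close>

lift_definition mconst :: "'a::comm_ring_1 \<Rightarrow> 'a mser" is "\<lambda>c M. if M = {#} then c else 0" .

lift_definition mvar :: "nat \<Rightarrow> 'a::comm_ring_1 mser" is "\<lambda>u M. if M = {#u#} then 1 else 0" .

lemma mcoeff_mconst_mult [simp]: "mcoeff (mconst c * F) M = c * mcoeff F M"
proof -
  have "mcoeff (mconst c * F) M = (\<Sum>A | A \<subseteq># M. if A = {#} then c * mcoeff F (M - A) else 0)"
    unfolding times_mser.rep_eq mconst.rep_eq by (rule sum.cong) auto
  then show ?thesis by (simp add: sum.delta)
qed

lemma mcoeff_mvar_mult: "mcoeff (mvar u * F) M = (if u \<in># M then mcoeff F (M - {#u#}) else 0)"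
proof -
  have "mcoeff (mvar u * F) M = (\<Sum>A | A \<subseteq># M. if A = {#u#} then mcoeff F (M - A) else 0)"
    unfolding times_mser.rep_eq mvar.rep_eq by (rule sum.cong) auto
  then show ?thesis by (simp add: sum.delta)
qed

lemma mconst_add: "mconst (a + b) = mconst a + mconst b"
  and mconst_diff: "mconst (a - b) = mconst a - mconst b"
  and mconst_1: "mconst 1 = 1"
  and mconst_0: "mconst 0 = 0"
  by (rule mser_eqI; simp add: mser_simps mconst.rep_eq)+

lemma mconst_mult: "mconst (a * b) = mconst a * mconst b"
  by (rule mser_eqI) (simp add: mconst.rep_eq)

text \<open>This replaces division by \<open>1 - t\<close>, which is not a unit of Z[t]; an integral
  domain still allows cancellation in each coefficient.\<close>

lemma mconst_cancel:
  fixes c :: "'a::idom"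
  assumes "c \<noteq> 0" "mconst c * F = mconst c * G"
  shows "F = G"
proof (rule mser_eqI)
  fix M
  have "c * mcoeff F M = c * mcoeff G M"
    by (metis assms(2) mcoeff_mconst_mult)
  then show "mcoeff F M = mcoeff G M" using assms(1) by simp
qed

text \<open>In the coefficient of \<open>F * G\<close> at M the empty submultiset contributes the
  coefficient of G at M itself, and all other terms involve G in smaller degree only. Induction on
  the degree thus avoids constructing an inverse of F.\<close>

lemma mult_cancel_unit:
  assumes "mcoeff F {#} = 1" "F * G = F * K"
  shows "G = K"
proof (rule mser_eqI)
  fix M
  show "mcoeff G M = mcoeff K M"
  proof (induction "size M" arbitrary: M rule: less_induct)
    case less
    have split: "mcoeff (F * L) M = mcoeff L M + (\<Sum>A\<in>{A. A \<subseteq># M} - {{#}}. mcoeff F A * mcoeff L (M - A))"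
      for L
      unfolding times_mser.rep_eq using assms(1) by (subst sum.remove[of _ "{#}"]) auto
    have "(\<Sum>A\<in>{A. A \<subseteq># M} - {{#}}. mcoeff F A * mcoeff G (M - A))
        = (\<Sum>A\<in>{A. A \<subseteq># M} - {{#}}. mcoeff F A * mcoeff K (M - A))"
    proof (rule sum.cong[OF refl])
      fix A assume A: "A \<in> {A. A \<subseteq># M} - {{#}}"
      then have "size (M - A) < size M"
        by (simp add: size_Diff_submset)
           (metis diff_less nonempty_has_size size_mset_mono less_le_trans)
      then show "mcoeff F A * mcoeff G (M - A) = mcoeff F A * mcoeff K (M - A)"
        using less by simp
    qed
    with split[of G] split[of K] assms(2) show ?case by simp
  qed
qed

text \<open>This is the product of the geometric series 1/(1 - c x_u) over u in A, that is H(cz)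
  restricted to the variables in A; A may be infinite.\<close>

lift_definition hseries :: "'a::comm_ring_1 \<Rightarrow> nat set \<Rightarrow> 'a mser"
  is "\<lambda>c A M. if set_mset M \<subseteq> A then c ^ size M else 0" .

lemma hseries_empty: "hseries c {} = 1"
  by (rule mser_eqI) (simp add: hseries.rep_eq mser_simps)

lemma hseries_remove:
  assumes "u \<in> A"
  shows "(1 - mconst c * mvar u) * hseries c A = hseries c (A - {u})"
proof (rule mser_eqI)
  fix M
  have "mcoeff ((1 - mconst c * mvar u) * hseries c A) M
      = mcoeff (hseries c A) M - mcoeff (mconst c * (mvar u * hseries c A)) M"
    by (simp add: algebra_simps mser_simps)
  also have "\<dots> = mcoeff (hseries c (A - {u})) M"
  proof (cases "u \<in># M")
    case True
    then obtain N where "M = add_mset u N" by (metis insert_DiffM)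
    then show ?thesis using assms by (auto simp: hseries.rep_eq mcoeff_mvar_mult)
  next
    case False
    then show ?thesis by (auto simp: hseries.rep_eq mcoeff_mvar_mult)
  qed
  finally show "mcoeff ((1 - mconst c * mvar u) * hseries c A) M = mcoeff (hseries c (A - {u})) M" .
qed

subsection \<open>Homogeneous components\<close>

text \<open>The variable z of the overview is not represented: the coefficient of
  \<open>z\<^sup>n\<close> is the part of degree n.\<close>

lift_definition mgrade :: "nat \<Rightarrow> 'a::comm_ring_1 mser \<Rightarrow> 'a mser"
  is "\<lambda>n F M. if size M = n then F M else 0" .

lemma mgrade_add: "mgrade n (F + G) = mgrade n F + mgrade n G"
  by (rule mser_eqI) (simp add: mgrade.rep_eq mser_simps)

lemma mgrade_one: "mgrade n 1 = (if n = 0 then 1 else 0)"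
  by (rule mser_eqI) (auto simp: mgrade.rep_eq mser_simps)

lemma mgrade_mult: "mgrade n (F * G) = (\<Sum>m\<le>n. mgrade m F * mgrade (n - m) G)"
proof (rule mser_eqI)
  fix M :: "nat multiset"
  have "mcoeff (\<Sum>m\<le>n. mgrade m F * mgrade (n - m) G) M
    = (\<Sum>A | A \<subseteq># M. \<Sum>m\<le>n. if m = size A then
        (if size (M - A) = n - m then mcoeff F A * mcoeff G (M - A) else 0) else 0)"
    unfolding mcoeff_sum times_mser.rep_eq mgrade.rep_eq
    by (subst sum.swap) (auto intro!: sum.cong)
  also have "\<dots> = (\<Sum>A | A \<subseteq># M. if size A \<le> n \<and> size (M - A) = n - size A
      then mcoeff F A * mcoeff G (M - A) else 0)"
    by (intro sum.cong) (auto simp: sum.delta)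
  also have "\<dots> = (\<Sum>A | A \<subseteq># M. if size M = n then mcoeff F A * mcoeff G (M - A) else 0)"
  proof (rule sum.cong[OF refl])
    fix A assume "A \<in> {A. A \<subseteq># M}"
    then have "A \<subseteq># M" by simp
    then have "size (M - A) = size M - size A" "size A \<le> size M"
      by (auto simp: size_Diff_submset size_mset_mono)
    then have "size A \<le> n \<and> size (M - A) = n - size A \<longleftrightarrow> size M = n" by auto
    then show "(if size A \<le> n \<and> size (M - A) = n - size A then mcoeff F A * mcoeff G (M - A) else 0)
      = (if size M = n then mcoeff F A * mcoeff G (M - A) else 0)" by simp
  qed
  also have "\<dots> = mcoeff (mgrade n (F * G)) M"
    by (simp add: mgrade.rep_eq times_mser.rep_eq)
  finally show "mcoeff (mgrade n (F * G)) M = mcoeff (\<Sum>m\<le>n. mgrade m F * mgrade (n - m) G) M" ..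
qed

section \<open>Banners\<close>

text \<open>The recursion from the front makes prepending a letter a condition on that letter and
  the old head only, as the first-letter recursion requires.\<close>

fun banner :: "nat \<Rightarrow> letter list \<Rightarrow> bool" where
  "banner l [] = True"
| "banner l (x # w) \<longleftrightarrow> valid_letter l x \<and> (if w = [] then \<forall>u. x \<noteq> Bar u else follow_ok x (hd w)) \<and> banner l w"

definition banners :: "nat \<Rightarrow> nat multiset \<Rightarrow> letter list set" where
  "banners l M = {w. banner l w \<and> mset (map absv w) = M}"

definition word_stat :: "nat \<Rightarrow> letter list \<Rightarrow> nat" where
  "word_stat l w = sum_list (map (letter_stat l) w)"

lemma banner_valid: "banner l w \<Longrightarrow> x \<in> set w \<Longrightarrow> valid_letter l x"
  by (induction w) auto

lemma valid_absv_pos: "valid_letter l x \<Longrightarrow> 1 \<le> absv x"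
  by (cases x) auto

definition letters :: "nat \<Rightarrow> nat \<Rightarrow> letter set" where
  "letters l u = insert (Bar u) (Let u ` {..<l})"

lemma letters_iff: "1 \<le> u \<Longrightarrow> x \<in> letters l u \<longleftrightarrow> valid_letter l x \<and> absv x = u"
  by (cases x) (auto simp: letters_def)

lemma finite_letters [simp]: "finite (letters l u)"
  by (simp add: letters_def)

lemma finite_banners [simp]: "finite (banners l M)"
proof (rule finite_subset)
  show "banners l M \<subseteq> {w. set w \<subseteq> (\<Union>u\<in>set_mset M. letters l u) \<and> length w = size M}"
  proof
    fix w assume "w \<in> banners l M"
    then have w: "banner l w" and M: "M = mset (map absv w)" by (auto simp: banners_def)
    have "x \<in> letters l (absv x)" if "x \<in> set w" for x
      using banner_valid[OF w that] letters_iff valid_absv_pos by blast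
    then show "w \<in> {w. set w \<subseteq> (\<Union>u\<in>set_mset M. letters l u) \<and> length w = size M}"
      unfolding M by fastforce
  qed
qed (simp add: finite_lists_length_eq)

definition tt :: "int poly" where "tt = monom 1 1"

lemma one_minus_tt: "1 - tt \<noteq> 0"
proof
  assume "1 - tt = 0"
  then have "poly (1 - tt) 0 = 0" by simp
  then show False by (simp add: tt_def poly_monom)
qed

lemma tt_power: "tt ^ k = monom 1 k"
  by (induction k) (simp_all add: tt_def mult_monom)

lift_definition banner_series :: "nat \<Rightarrow> (letter list \<Rightarrow> bool) \<Rightarrow> int poly mser"
  is "\<lambda>l P M. \<Sum>w | w \<in> banners l M \<and> P w. tt ^ word_stat l w" .

text \<open>The t-analogue \<open>[n]\<close> of n. Its value 0 at n = 0 later stands for an empty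
  interval.\<close>

definition qint :: "nat \<Rightarrow> int poly" where
  "qint n = (\<Sum>i<n. tt ^ i)"

lemma qint_Suc: "qint (Suc n) = 1 + tt * qint n"
  by (simp add: qint_def sum.lessThan_Suc_shift sum_distrib_left del: sum.lessThan_Suc)

lemma qint_Suc': "qint (Suc n) = qint n + tt ^ n"
  by (simp add: qint_def)

lemma qint_mult: "(1 - tt) * qint n = 1 - tt ^ n"
  by (simp add: qint_def one_diff_power_eq)

text \<open>Before a larger head, or alone, only the barred letter is excluded, leaving all l
  colors: \<open>[l]\<close>. Before a smaller head color 0 is excluded and the barred letter
  allowed, giving t + ... + \<open>t\<^sup>l\<close> = \<open>t [l]\<close>. Before an equal
  absolute value all l + 1 letters are allowed.\<close>

lemma sum_first_letter:
  assumes l: "1 \<le> l" and u: "1 \<le> u" and w: "banner l w"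
  shows "(\<Sum>x | absv x = u \<and> banner l (x # w). tt ^ letter_stat l x)
    = (if w = [] \<or> u < absv (hd w) then qint l
       else tt * qint l + (if absv (hd w) = u then 1 else 0))"
proof -
  have Let_sum: "(\<Sum>x\<in>Let u ` A. tt ^ letter_stat l x) = (\<Sum>m\<in>A. tt ^ m)" for A
    by (subst sum.reindex) (auto simp: inj_on_def letter_stat_def)
  have Let_fin: "Bar u \<notin> Let u ` A" for A by auto
  have set: "{x. absv x = u \<and> banner l (x # w)} = {x \<in> letters l u. if w = [] then \<forall>u. x \<noteq> Bar u else follow_ok x (hd w)}"
    using w letters_iff[OF u, of _ l] by auto
  obtain l' where l': "l = Suc l'" using l by (cases l) auto
  have shift: "(\<Sum>m\<in>{1..<l}. tt ^ m) = tt * qint l'"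
    unfolding qint_def l' sum_distrib_left
    by (rule sum.reindex_bij_witness[of _ Suc "\<lambda>m. m - 1"])
       (auto simp flip: power_Suc)
  consider "w = [] \<or> u < absv (hd w)" | "w \<noteq> []" "absv (hd w) < u" | "w \<noteq> []" "absv (hd w) = u"
    by linarith
  then show ?thesis
  proof cases
    case 1
    then have "{x. absv x = u \<and> banner l (x # w)} = Let u ` {..<l}"
      unfolding set by (auto simp: letters_def follow_ok_def)
    with 1 show ?thesis by (simp add: Let_sum qint_def del: banner.simps)
  next
    case 2
    then have "{x. absv x = u \<and> banner l (x # w)} = insert (Bar u) (Let u ` {1..<l})"
      unfolding set by (auto simp: letters_def follow_ok_def image_iff)
    then have "(\<Sum>x | absv x = u \<and> banner l (x # w). tt ^ letter_stat l x) = tt ^ l + tt * qint l'"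
      by (simp only: sum.insert[OF finite_imageI[OF finite_atLeastLessThan] Let_fin] Let_sum shift)
         (simp add: letter_stat_def)
    also have "\<dots> = tt * qint l" by (simp add: l' qint_Suc' algebra_simps)
    finally show ?thesis using 2 by simp
  next
    case 3
    then have "{x. absv x = u \<and> banner l (x # w)} = insert (Bar u) (Let u ` {..<l})"
      unfolding set by (auto simp: letters_def follow_ok_def)
    then have "(\<Sum>x | absv x = u \<and> banner l (x # w). tt ^ letter_stat l x) = tt ^ l + qint l"
      by (simp only: sum.insert[OF finite_imageI[OF finite_lessThan] Let_fin] Let_sum qint_def)
         (simp add: letter_stat_def)
    also have "\<dots> = tt * qint l + 1" using qint_Suc[of l] qint_Suc'[of l] by (simp add: add.commute)
    finally show ?thesis using 3 by simp
  qed
qed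

text \<open>Delete the first letter. \<open>T - S\<close> collects the remainders that are empty or
  start above u, S those that start at u or below, and the last summand is the extra 1 for
  remainders that start exactly at u.\<close>

lemma banner_series_first_letter:
  assumes l: "1 \<le> l" and u: "1 \<le> u"
  defines "S \<equiv> banner_series l (\<lambda>w. w \<noteq> [] \<and> absv (hd w) \<le> u)"
  shows "banner_series l (\<lambda>w. w \<noteq> [] \<and> absv (hd w) = u) =
    mvar u * (mconst (qint l) * (banner_series l (\<lambda>_. True) - S) + mconst (tt * qint l) * S
      + banner_series l (\<lambda>w. w \<noteq> [] \<and> absv (hd w) = u))" (is "?B = mvar u * ?R")
proof (rule mser_eqI)
  fix M
  show "mcoeff ?B M = mcoeff (mvar u * ?R) M"
  proof (cases "u \<in># M")
    case False
    then have "{w. w \<in> banners l M \<and> w \<noteq> [] \<and> absv (hd w) = u} = {}"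
      by (auto simp: banners_def neq_Nil_conv)
    then have "mcoeff ?B M = 0" unfolding banner_series.rep_eq by (simp only: sum.empty)
    with False show ?thesis by (simp add: mcoeff_mvar_mult)
  next
    case True
    then obtain N where M: "M = add_mset u N" by (metis insert_DiffM)
    let ?f = "\<lambda>w. \<Sum>x | absv x = u \<and> banner l (x # w). tt ^ letter_stat l x"
    let ?T = "SIGMA w:banners l N. {x. absv x = u \<and> banner l (x # w)}"
    have fin: "finite {x. absv x = u \<and> banner l (x # w)}" for w
      by (rule finite_subset[OF _ finite_letters[of l u]]) (use letters_iff[OF u] in auto)
    have "mcoeff ?B M = (\<Sum>(w, x)\<in>?T. tt ^ word_stat l (x # w))"
      unfolding banner_series.rep_eq
      by (rule sum.reindex_bij_witness[of _ "\<lambda>(w, x). x # w" "\<lambda>w. (tl w, hd w)"])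
         (auto simp: banners_def M neq_Nil_conv)
    also have "\<dots> = (\<Sum>w\<in>banners l N. tt ^ word_stat l w * ?f w)"
      by (subst sum.Sigma[symmetric])
         (auto simp del: banner.simps simp: fin word_stat_def power_add sum_distrib_left mult.commute)
    also have "\<dots> = (\<Sum>w\<in>banners l N. tt ^ word_stat l w *
        (if w = [] \<or> u < absv (hd w) then qint l
         else tt * qint l + (if absv (hd w) = u then 1 else 0)))"
      using sum_first_letter[OF l u] by (intro sum.cong) (auto simp: banners_def)
    also have "\<dots> = (\<Sum>w\<in>banners l N.
        qint l * (tt ^ word_stat l w - (if w \<noteq> [] \<and> absv (hd w) \<le> u then tt ^ word_stat l w else 0))
        + tt * qint l * (if w \<noteq> [] \<and> absv (hd w) \<le> u then tt ^ word_stat l w else 0)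
        + (if w \<noteq> [] \<and> absv (hd w) = u then tt ^ word_stat l w else 0))"
      by (intro sum.cong) (auto simp: algebra_simps)
    also have "\<dots> = mcoeff ?R N"
      by (simp add: mser_simps S_def banner_series.rep_eq sum.distrib sum_subtractf
          sum.inter_filter[symmetric] flip: sum_distrib_left)
    finally show ?thesis using M by (simp add: mcoeff_mvar_mult)
  qed
qed

text \<open>The first factor \<open>Z\<^sub>n\<close> on the left telescopes: the recursion by first letters becomes
  \<open>(1 - t\<^sup>l x\<^sub>n) Z\<^sub>n = (1 - x\<^sub>n) Z\<^sub>n\<^sub>-\<^sub>1\<close>.\<close>

lemma banner_series_conv_hseries:
  assumes l: "1 \<le> l"
  defines "T \<equiv> banner_series l (\<lambda>_. True)"
  shows "(T - mconst (1 - tt) * banner_series l (\<lambda>w. w \<noteq> [] \<and> absv (hd w) \<le> n)) * hseries 1 {1..n}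
    = T * hseries (tt ^ l) {1..n}"
proof (induction n)
  case 0
  have "{w. w \<in> banners l M \<and> w \<noteq> [] \<and> absv (hd w) \<le> 0} = {}" for M
  proof -
    have "1 \<le> absv (hd w)" if "w \<in> banners l M" "w \<noteq> []" for w
      using that banner_valid[of l w "hd w"] valid_absv_pos by (simp add: banners_def)
    then show ?thesis by fastforce
  qed
  then have "banner_series l (\<lambda>w. w \<noteq> [] \<and> absv (hd w) \<le> 0) = 0"
    by (intro mser_eqI) (simp only: banner_series.rep_eq mser_simps sum.empty)
  then show ?case by (simp add: hseries_empty)
next
  case (Suc n)
  define q where "q = tt ^ l"
  define x :: "int poly mser" where "x = mvar (Suc n)"
  define S where "S k = banner_series l (\<lambda>w. w \<noteq> [] \<and> absv (hd w) \<le> k)" for k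
  define B where "B = banner_series l (\<lambda>w. w \<noteq> [] \<and> absv (hd w) = Suc n)"
  define Z where "Z k = T - mconst (1 - tt) * S k" for k
  have S: "S (Suc n) = S n + B"
  proof (rule mser_eqI)
    fix M
    have "{w. w \<in> banners l M \<and> w \<noteq> [] \<and> absv (hd w) \<le> Suc n} =
      {w. w \<in> banners l M \<and> w \<noteq> [] \<and> absv (hd w) \<le> n} \<union> {w. w \<in> banners l M \<and> w \<noteq> [] \<and> absv (hd w) = Suc n}"
      by auto
    then show "mcoeff (S (Suc n)) M = mcoeff (S n + B) M"
      unfolding S_def B_def mser_simps banner_series.rep_eq
      by (simp only:) (rule sum.union_disjoint; force)
  qed
  have B: "B = x * (mconst (qint l) * (T - S (Suc n)) + mconst (tt * qint l) * S (Suc n) + B)"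
    using banner_series_first_letter[OF l, of "Suc n"]
    unfolding B_def x_def S_def T_def by simp
  have q: "mconst (1 - tt) * mconst (qint l) = 1 - mconst q"
    unfolding mconst_mult[symmetric] qint_mult by (simp add: q_def mconst_diff mconst_1)
  \<comment> \<open>In this form the two kinds of remainders, weighted 1 and t, combine into
    \<open>Z\<close>, so the recursion for B mentions only \<open>Z\<close> and B.\<close>
  have Z1: "Z (Suc n) = T - S (Suc n) + mconst tt * S (Suc n)"
    by (simp add: Z_def mconst_diff mconst_1 algebra_simps)
  have Z2: "Z n = Z (Suc n) + mconst (1 - tt) * B"
    by (simp add: Z_def S algebra_simps)
  have "B = x * (mconst (qint l) * Z (Suc n) + B)"
    unfolding Z1 by (subst B) (simp add: mconst_mult algebra_simps)
  then have "mconst (1 - tt) * B = mconst (1 - tt) * (x * (mconst (qint l) * Z (Suc n) + B))"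
    by simp
  also have "\<dots> = x * ((mconst (1 - tt) * mconst (qint l)) * Z (Suc n) + mconst (1 - tt) * B)"
    by (simp add: algebra_simps)
  finally have "mconst (1 - tt) * B = x * ((1 - mconst q) * Z (Suc n) + mconst (1 - tt) * B)"
    unfolding q .
  then have step: "(1 - mconst q * x) * Z (Suc n) = (1 - x) * Z n"
    unfolding Z2 by (simp add: algebra_simps)
  have del: "{1..Suc n} - {Suc n} = {1..n}" by auto
  have h: "(1 - mconst c * x) * hseries c {1..Suc n} = hseries c {1..n}" for c
    unfolding x_def using hseries_remove[of "Suc n" "{1..Suc n}" c] del by simp
  have "(1 - mconst q * x) * (Z (Suc n) * hseries 1 {1..Suc n})
      = ((1 - mconst q * x) * Z (Suc n)) * hseries 1 {1..Suc n}" by (simp only: mult.assoc)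
  also have "\<dots> = Z n * ((1 - mconst 1 * x) * hseries 1 {1..Suc n})"
    unfolding step mconst_1 by (simp add: mult_ac)
  also have "\<dots> = T * hseries q {1..n}"
    unfolding h using Suc.IH by (simp add: Z_def S_def q_def)
  also have "\<dots> = (1 - mconst q * x) * (T * hseries q {1..Suc n})"
    using h[of q] by (metis mult.left_commute)
  finally have "Z (Suc n) * hseries 1 {1..Suc n} = T * hseries q {1..Suc n}"
    by (rule mult_cancel_unit[rotated]) (simp add: mser_simps x_def mvar.rep_eq)
  then show ?case unfolding Z_def S_def q_def .
qed

text \<open>The limit of the previous identity: if n bounds the variables of M, then on submultisets
  of M every nonempty banner starts at n or below, so the restricted series there equals T -
  1.\<close>

lemma banner_series_equation:
  assumes l: "1 \<le> l"
  defines "T \<equiv> banner_series l (\<lambda>_. True)"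
  shows "T * (hseries (tt ^ l) {1..} - mconst tt * hseries 1 {1..}) = mconst (1 - tt) * hseries 1 {1..}"
proof -
  have "(mconst tt * T + mconst (1 - tt)) * hseries 1 {1..} = T * hseries (tt ^ l) {1..}"
  proof (rule mser_eqI)
    fix M :: "nat multiset"
    obtain n where n: "\<forall>u\<in>#M. u \<le> n" using finite_nat_set_iff_bounded_le[of "set_mset M"] by auto
    define S where "S = banner_series l (\<lambda>w. w \<noteq> [] \<and> absv (hd w) \<le> n)"
    have h: "mcoeff (hseries c {1..}) A = mcoeff (hseries c {1..n}) A" if "A \<subseteq># M" for A and c :: "int poly"
      using n mset_subset_eqD[OF that] by (auto simp: hseries.rep_eq)
    have S: "mcoeff (mconst tt * T + mconst (1 - tt)) A = mcoeff (T - mconst (1 - tt) * S) A"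
      if "A \<subseteq># M" for A
    proof -
      have "{w. w \<in> banners l A \<and> w \<noteq> [] \<and> absv (hd w) \<le> n} = banners l A - {[]}"
      proof -
        have "absv (hd w) \<in># M" if "w \<in> banners l A" "w \<noteq> []" for w
          using that mset_subset_eqD[OF \<open>A \<subseteq># M\<close>] by (auto simp: banners_def)
        then show ?thesis using n by auto
      qed
      then have "mcoeff S A = (\<Sum>w\<in>banners l A - {[]}. tt ^ word_stat l w)"
        by (simp only: S_def banner_series.rep_eq)
      also have "\<dots> = mcoeff T A - (if [] \<in> banners l A then tt ^ word_stat l [] else 0)"
        unfolding T_def banner_series.rep_eq by (subst sum_diff1) auto
      also have "\<dots> = mcoeff T A - (if A = {#} then 1 else 0)"
        by (auto simp: banners_def word_stat_def)
      finally have "mcoeff S A = mcoeff T A - (if A = {#} then 1 else 0)" .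
      moreover have "mcoeff (mconst tt * T + mconst (1 - tt)) A
          = tt * mcoeff T A + (1 - tt) * (if A = {#} then 1 else 0)"
        by (simp only: mser_simps mcoeff_mconst_mult mconst.rep_eq) simp
      moreover have "mcoeff (T - mconst (1 - tt) * S) A = mcoeff T A - (1 - tt) * mcoeff S A"
        by (simp only: mser_simps mcoeff_mconst_mult)
      moreover have "tt * y + (1 - tt) * e = y - (1 - tt) * (y - e)" for y e :: "int poly"
        by (simp add: algebra_simps)
      ultimately show ?thesis by (simp only:)
    qed
    have "mcoeff ((mconst tt * T + mconst (1 - tt)) * hseries 1 {1..}) M
      = mcoeff ((T - mconst (1 - tt) * S) * hseries 1 {1..n}) M"
      unfolding times_mser.rep_eq using S h by (intro sum.cong) auto
    also have "\<dots> = mcoeff (T * hseries (tt ^ l) {1..n}) M"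
      unfolding S_def T_def banner_series_conv_hseries[OF l] ..
    also have "\<dots> = mcoeff (T * hseries (tt ^ l) {1..}) M"
      unfolding times_mser.rep_eq using h by (intro sum.cong) auto
    finally show "mcoeff ((mconst tt * T + mconst (1 - tt)) * hseries 1 {1..}) M
      = mcoeff (T * hseries (tt ^ l) {1..}) M" .
  qed
  then show ?thesis by (simp add: algebra_simps)
qed

section \<open>Recursions for the generating functions\<close>

text \<open>This is the sum of \<open>f n * h\<^sub>n\<close> over all n. The variable with index 0
  is left out because letters have absolute value at least 1, in agreement with
  \<open>hfun\<close>.\<close>

lift_definition weighted_hseries :: "(nat \<Rightarrow> 'a::comm_ring_1) \<Rightarrow> 'a mser"
  is "\<lambda>f M. if 0 \<in># M then 0 else f (size M)" .

definition hcomp :: "nat \<Rightarrow> int poly mser" where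
  "hcomp n = weighted_hseries (\<lambda>m. if m = n then 1 else 0)"

lemma set_mset_pos: "set_mset M \<subseteq> {Suc 0..} \<longleftrightarrow> 0 \<notin># M" for M :: "nat multiset"
  by (auto simp: Suc_le_eq intro: ccontr)

lemma hcomp_0: "hcomp 0 = 1"
  by (rule mser_eqI) (auto simp: hcomp_def weighted_hseries.rep_eq mser_simps)

lemma mgrade_weighted_hseries: "mgrade n (weighted_hseries f) = mconst (f n) * hcomp n"
  by (rule mser_eqI) (auto simp: mgrade.rep_eq weighted_hseries.rep_eq hcomp_def)

lemma hseries_one_conv: "hseries 1 {1..} = weighted_hseries (\<lambda>_. 1)"
  by (rule mser_eqI) (simp add: hseries.rep_eq weighted_hseries.rep_eq set_mset_pos)

text \<open>For n \<ge> 1 the coefficient of \<open>h\<^sub>n\<close> in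
  \<open>H(t\<^sup>lz) - t H(z)\<close> is \<open>t\<^sup>l\<^sup>n - t\<close>, which is -(1 - t)
  times \<open>t [ln - 1]\<close>; for n = 0 it is 1 - t. So the banner equation reads H D (1 - t)(1
  - W) = H (1 - t), and H and 1 - t cancel.\<close>

lemma derangement_series_recursions:
  assumes l: "1 \<le> l" and T: "banner_series l (\<lambda>_. True) = hseries 1 {1..} * D"
  shows "D = 1 + weighted_hseries (\<lambda>n. if n = 0 then 0 else tt * qint (l * n - 1)) * D"
    and "banner_series l (\<lambda>_. True) = 1 + weighted_hseries (\<lambda>n. qint (l * n)) * D"
proof -
  let ?H = "hseries 1 {1..} :: int poly mser"
  define W where "W = weighted_hseries (\<lambda>n. if n = 0 then 0 else tt * qint (l * n - 1))"
  define V where "V = weighted_hseries (\<lambda>n. qint (l * n))"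
  have W: "hseries (tt ^ l) {1..} - mconst tt * ?H = mconst (1 - tt) * (1 - W)"
  proof (rule mser_eqI)
    fix M
    have "(tt ^ l) ^ n - tt = (1 - tt) * (- (tt * qint (l * n - 1)))" if n: "n \<noteq> 0" for n
    proof -
      obtain k where k: "l * n = Suc k" using n l by (cases "l * n") auto
      have "(1 - tt) * (- (tt * qint k)) = - tt * ((1 - tt) * qint k)" by (simp add: algebra_simps)
      also have "\<dots> = tt ^ Suc k - tt" unfolding qint_mult by (simp add: algebra_simps)
      finally show ?thesis by (simp add: power_mult[symmetric] k)
    qed
    then show "mcoeff (hseries (tt ^ l) {1..} - mconst tt * ?H) M = mcoeff (mconst (1 - tt) * (1 - W)) M"
      by (auto simp: mser_simps hseries.rep_eq W_def weighted_hseries.rep_eq set_mset_pos)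
  qed
  have "?H * (D * (mconst (1 - tt) * (1 - W))) = ?H * mconst (1 - tt)"
    using banner_series_equation[OF l] unfolding T W by (simp add: mult_ac)
  then have "D * (mconst (1 - tt) * (1 - W)) = mconst (1 - tt)"
    by (rule mult_cancel_unit[rotated]) (simp add: hseries.rep_eq)
  then have "mconst (1 - tt) * (D * (1 - W)) = mconst (1 - tt) * 1"
    by (simp add: mult_ac)
  then have DW: "D * (1 - W) = 1"
    using mconst_cancel[OF one_minus_tt] by blast
  then show D: "D = 1 + W * D" by (simp add: algebra_simps)
  \<comment> \<open>Since \<open>1 + t [ln - 1] = [ln]\<close>, H splits as V + (1 - W); multiplied
    by D the second part becomes 1.\<close>
  have "?H - (1 - W) = V"
  proof (rule mser_eqI)
    fix M
    have "1 + tt * qint (l * n - 1) = qint (l * n)" if "n \<noteq> 0" for n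
      using qint_Suc[of "l * n - 1"] that l by simp
    then show "mcoeff (?H - (1 - W)) M = mcoeff V M"
      by (auto simp: mser_simps hseries.rep_eq W_def V_def weighted_hseries.rep_eq set_mset_pos qint_def)
  qed
  then have "?H = V + (1 - W)" by (metis diff_add_cancel)
  then have "?H * D = V * D + D * (1 - W)" by (simp only: distrib_right mult.commute[of D "1 - W"])
  then show "banner_series l (\<lambda>_. True) = 1 + V * D" unfolding T DW by simp
qed

section \<open>Symmetric and unimodal combinations of complete homogeneous products\<close>

definition hprod :: "nat multiset \<Rightarrow> int poly mser" where
  "hprod lam = (\<Prod>m\<in>#lam. hcomp m)"

lemma hprod_add: "hprod (lam + mu) = hprod lam * hprod mu"
  by (simp add: hprod_def)

text \<open>Nonnegative combinations of the products of an interval \<open>t\<^sup>a + \<dots> + t\<^sup>N\<^sup>-\<^sup>a\<close> with some \<open>h\<close>,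
  all with the same center \<open>N/2\<close>.\<close>

inductive centered :: "nat \<Rightarrow> int poly mser \<Rightarrow> bool" for N where
  centered_zero: "centered N 0"
| centered_step: "2 * a \<le> N \<Longrightarrow> 0 \<notin># lam \<Longrightarrow> centered N F
    \<Longrightarrow> centered N (mconst (tt ^ a * qint (N + 1 - 2 * a)) * hprod lam + F)"

lemma centered_add: "centered N F \<Longrightarrow> centered N G \<Longrightarrow> centered N (F + G)"
proof (induction rule: centered.induct)
  case (centered_step a lam F)
  then show ?case unfolding add.assoc by (intro centered.centered_step)
qed simp

lemma centered_sum: "(\<And>x. x \<in> A \<Longrightarrow> centered N (f x)) \<Longrightarrow> centered N (sum f A)"
  by (induction A rule: infinite_finite_induct) (auto intro: centered_zero centered_add)

text \<open>For \<open>2 * a > N\<close> truncated subtraction turns the interval into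
  \<open>qint 0\<close>, and the zero series is centered.\<close>

lemma centered_interval:
  assumes "0 \<notin># lam"
  shows "centered N (mconst (tt ^ a * qint (N + 1 - 2 * a)) * hprod lam)"
proof (cases "2 * a \<le> N")
  case True
  from centered_step[OF True assms centered_zero] show ?thesis by simp
next
  case False
  then have "qint (N + 1 - 2 * a) = 0" by (simp add: qint_def)
  then show ?thesis by (simp add: mconst_0 centered_zero)
qed

text \<open>As \<open>centered\<close> admits positive parts only, \<open>hcomp 0 = 1\<close> has to
  be read as the empty product.\<close>

lemma centered_hcomp: "centered N (mconst (tt ^ a * qint (N + 1 - 2 * a)) * hcomp m)"
  using centered_interval[of "{#}" N a] centered_interval[of "{#m#}" N a]
  by (cases "m = 0") (simp_all add: hprod_def hcomp_0)

text \<open>Splits off the longest of the nested intervals whose sum is the product of two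
  intervals. It is verified after multiplication by the square of 1 - t.\<close>

lemma qint_Suc_mult: "qint (Suc b) * qint (Suc d) = qint (Suc (b + d)) + tt * (qint b * qint d)"
proof -
  have "(1 - tt) * ((1 - tt) * (qint (Suc b) * qint (Suc d)))
      = ((1 - tt) * qint (Suc b)) * ((1 - tt) * qint (Suc d))" by (simp only: mult_ac)
  also have "\<dots> = (1 - tt) * ((1 - tt) * qint (Suc (b + d))) + tt * (((1 - tt) * qint b) * ((1 - tt) * qint d))"
    unfolding qint_mult by (simp add: algebra_simps power_add)
  also have "\<dots> = (1 - tt) * ((1 - tt) * (qint (Suc (b + d)) + tt * (qint b * qint d)))"
    by (simp only: distrib_left mult_ac)
  finally have "(1 - tt) * ((1 - tt) * (qint (Suc b) * qint (Suc d)))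
    = (1 - tt) * ((1 - tt) * (qint (Suc (b + d)) + tt * (qint b * qint d)))" .
  then show ?thesis using one_minus_tt by simp
qed

text \<open>Repeated splitting leaves nested intervals with a common center. The center of
  \<open>t\<^sup>a [b] [d]\<close> is a + (b - 1)/2 + (d - 1)/2, and setting this equal to N/2 gives
  the equation with N + 2.\<close>

lemma centered_qint_mult:
  assumes "0 \<notin># lam" "N + 2 = 2 * a + b + d"
  shows "centered N (mconst (tt ^ a * (qint b * qint d)) * hprod lam)"
  using assms(2)
proof (induction b arbitrary: a d)
  case 0
  then show ?case by (simp add: qint_def mconst_0 centered_zero)
next
  case (Suc b)
  show ?case
  proof (cases d)
    case 0
    then show ?thesis by (simp add: qint_def mconst_0 centered_zero)
  next
    case d: (Suc d')
    have "tt ^ a * (qint (Suc b) * qint d)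
        = tt ^ a * qint (N + 1 - 2 * a) + tt ^ Suc a * (qint b * qint d')"
      using Suc.prems unfolding d qint_Suc_mult by (simp add: algebra_simps)
    moreover have "centered N (mconst (tt ^ Suc a * (qint b * qint d')) * hprod lam)"
      using Suc.prems d by (intro Suc.IH) simp
    ultimately show ?thesis
      by (simp only: mconst_add distrib_right centered_add centered_interval[OF assms(1)])
  qed
qed

lemma centered_mult:
  assumes "centered N F" "centered M G"
  shows "centered (N + M) (F * G)"
  using assms(1)
proof (induction rule: centered.induct)
  case centered_zero
  then show ?case by (simp add: centered.centered_zero)
next
  case (centered_step a lam F)
  have "centered (N + M) (mconst (tt ^ a * qint (N + 1 - 2 * a)) * hprod lam * G)"
    using assms(2)
  proof (induction rule: centered.induct)
    case centered_zero
    then show ?case by (simp add: centered.centered_zero)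
  next
    case (centered_step c mu G)
    have "centered (N + M)
        (mconst (tt ^ (a + c) * (qint (N + 1 - 2 * a) * qint (M + 1 - 2 * c))) * hprod (lam + mu))"
      using \<open>2 * a \<le> N\<close> \<open>2 * c \<le> M\<close> \<open>0 \<notin># lam\<close> \<open>0 \<notin># mu\<close> by (intro centered_qint_mult) auto
    then show ?case
      using centered_step.IH
      by (simp add: distrib_left power_add mconst_mult hprod_add centered_add mult_ac)
  qed
  then show ?case using centered_step.IH by (simp add: distrib_right centered_add)
qed

text \<open>Because \<open>f 0 = 0\<close>, only degrees of D below n occur on the right, which
  permits induction on n when F is D itself.\<close>

lemma mgrade_recursion:
  assumes F: "F = 1 + weighted_hseries f * D" and f0: "f 0 = 0" and n: "1 \<le> n"
  shows "mgrade n F = (\<Sum>m=1..n. mconst (f m) * hcomp m * mgrade (n - m) D)"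
proof -
  have "mgrade n F = (\<Sum>m\<le>n. mconst (f m) * hcomp m * mgrade (n - m) D)"
    using n by (subst F) (simp add: mgrade_add mgrade_one mgrade_mult mgrade_weighted_hseries)
  also have "{..n} = insert 0 {1..n}" by auto
  finally show ?thesis by (simp add: f0 mconst_0)
qed

lemma mgrade_0_recursion:
  fixes D :: "int poly mser"
  assumes F: "F = 1 + weighted_hseries f * D" and f0: "f 0 = 0"
  shows "mgrade 0 F = 1"
  by (subst F) (simp add: mgrade_add mgrade_one mgrade_mult mgrade_weighted_hseries f0 mconst_0)

lemma centered_derangement_component:
  assumes l: "1 \<le> l"
    and D: "D = 1 + weighted_hseries (\<lambda>n. if n = 0 then 0 else tt * qint (l * n - 1)) * D"
  shows "centered (l * n) (mgrade n D)"
proof (induction n rule: less_induct)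
  case (less n)
  let ?f = "\<lambda>n. if n = 0 then 0 else tt * qint (l * n - 1)"
  show ?case
  proof (cases "n = 0")
    case True
    then show ?thesis
      using mgrade_0_recursion[OF D] centered_interval[of "{#}" 0 0] by (simp add: hprod_def qint_def mconst_1)
  next
    case False
    have "centered (l * n) (mconst (?f m) * hcomp m * mgrade (n - m) D)" if m: "m \<in> {1..n}" for m
    proof -
      \<comment> \<open>Here a = 1: the powers t, ...,
        \<open>t\<^sup>l\<^sup>m\<^sup>-\<^sup>1\<close> lie symmetrically around lm/2.\<close>
      have "centered (l * m) (mconst (?f m) * hcomp m)"
        using centered_hcomp[of "l * m" 1 m] m by simp
      moreover have "centered (l * (n - m)) (mgrade (n - m) D)"
        using m by (intro less.IH) auto
      moreover have "l * m + l * (n - m) = l * n"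
        using m by (simp flip: distrib_left)
      ultimately show ?thesis using centered_mult by metis
    qed
    then show ?thesis
      using False by (subst mgrade_recursion[OF D]) (auto intro: centered_sum)
  qed
qed

text \<open>The factor \<open>[lm]\<close> covers 0, ..., lm - 1 and has center (lm - 1)/2; it
  appears once, next to a component of D with center l(n - m)/2.\<close>

lemma centered_total_component:
  assumes l: "1 \<le> l" and n: "1 \<le> n"
    and D: "D = 1 + weighted_hseries (\<lambda>n. if n = 0 then 0 else tt * qint (l * n - 1)) * D"
    and T: "T = 1 + weighted_hseries (\<lambda>n. qint (l * n)) * D"
  shows "centered (l * n - 1) (mgrade n T)"
proof -
  have "centered (l * n - 1) (mconst (qint (l * m)) * hcomp m * mgrade (n - m) D)" if m: "m \<in> {1..n}" for m
  proof -
    have lm: "1 \<le> l * m" using l m by (cases "l * m") auto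
    then have "centered (l * m - 1) (mconst (qint (l * m)) * hcomp m)"
      using centered_hcomp[of "l * m - 1" 0 m] by simp
    moreover have "l * m + l * (n - m) = l * n"
      using m by (simp flip: distrib_left)
    then have "l * m - 1 + l * (n - m) = l * n - 1" using lm by simp
    ultimately show ?thesis
      using centered_mult centered_derangement_component[OF l D] by metis
  qed
  then show ?thesis
    using n by (subst mgrade_recursion[OF T]) (auto simp: qint_def intro: centered_sum)
qed

subsection \<open>Coefficients as functions of exponent vectors\<close>

text \<open>\<open>Abs_multiset\<close> is meaningful on finitely supported exponents only. The
  default 0 elsewhere matches \<open>Q\<close>, because ornaments are finite, and
  \<open>h_part\<close>, by the value of sums over infinite sets.\<close>

definition sf_coeff :: "int poly mser \<Rightarrow> nat \<Rightarrow> sf" where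
  "sf_coeff F k = (\<lambda>\<alpha>. if finite {u. \<alpha> u \<noteq> 0} then coeff (mcoeff F (Abs_multiset \<alpha>)) k else 0)"

lemma count_Abs_multiset': "finite {u. \<alpha> u \<noteq> 0} \<Longrightarrow> count (Abs_multiset \<alpha>) = \<alpha>"
  by (simp add: count_Abs_multiset)

lemma count_nonzero: "{u. count M u \<noteq> 0} = set_mset M"
  by (auto simp: count_eq_zero_iff)

lemma finite_count: "finite {u. count M u \<noteq> 0}"
  unfolding count_nonzero by simp

lemma hfun_count: "hfun p (count M) = (if 0 \<notin># M \<and> size M = p then 1 else 0)"
proof -
  have "(\<Sum>u\<in>{u. count M u \<noteq> 0}. count M u) = size M"
    by (simp only: count_nonzero size_multiset_overloaded_eq)
  then show ?thesis
    using finite_count[of M] by (simp add: hfun_def count_eq_zero_iff)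
qed

lemma sf_mult_count: "sf_mult f g (count M) = (\<Sum>A | A \<subseteq># M. f (count A) * g (count (M - A)))"
proof -
  have "{\<beta>. \<forall>u. \<beta> u \<le> count M u} = count ` {A. A \<subseteq># M}"
  proof (intro set_eqI iffI)
    fix \<beta> assume "\<beta> \<in> {\<beta>. \<forall>u. \<beta> u \<le> count M u}"
    then have le: "\<beta> u \<le> count M u" for u by simp
    have "{u. \<beta> u \<noteq> 0} \<subseteq> {u. count M u \<noteq> 0}"
    proof
      fix u assume "u \<in> {u. \<beta> u \<noteq> 0}"
      then show "u \<in> {u. count M u \<noteq> 0}" using le[of u] by (metis (mono_tags) mem_Collect_eq le_zero_eq)
    qed
    then have "finite {u. \<beta> u \<noteq> 0}" by (rule finite_subset) (rule finite_count)
    then have "count (Abs_multiset \<beta>) = \<beta>" by (rule count_Abs_multiset')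
    then show "\<beta> \<in> count ` {A. A \<subseteq># M}"
      using le by (intro image_eqI[of _ _ "Abs_multiset \<beta>"]) (auto simp: subseteq_mset_def)
  qed (auto simp: subseteq_mset_def)
  moreover have "inj_on count {A. A \<subseteq># M}" by (simp add: inj_on_def count_inject)
  ultimately show ?thesis
    by (simp add: sf_mult_def sum.reindex minus_multiset.rep_eq)
qed

lemma h_part_count: "mcoeff (hprod (mset lam)) M = [:h_part lam (count M):]"
proof (induction lam arbitrary: M)
  case Nil
  have "count M = (\<lambda>_. 0) \<longleftrightarrow> M = {#}" by (auto simp: fun_eq_iff multiset_eq_iff)
  then show ?case by (simp add: hprod_def h_part_def sf_one_def mser_simps one_pCons)
next
  case (Cons p lam)
  have "mcoeff (hprod (mset (p # lam))) M
      = (\<Sum>A | A \<subseteq># M. mcoeff (hcomp p) A * mcoeff (hprod (mset lam)) (M - A))"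
    by (simp add: hprod_def times_mser.rep_eq)
  also have "\<dots> = (\<Sum>A | A \<subseteq># M. [:hfun p (count A) * h_part lam (count (M - A)):])"
    unfolding Cons.IH by (intro sum.cong) (auto simp: hfun_count hcomp_def weighted_hseries.rep_eq)
  also have "\<dots> = [:\<Sum>A | A \<subseteq># M. hfun p (count A) * h_part lam (count (M - A)):]"
    by (induction rule: finite_induct[OF finite_submultisets]) auto
  also have "\<dots> = [:h_part (p # lam) (count M):]"
    by (simp add: h_part_def sf_mult_count)
  finally show ?case .
qed

text \<open>The unit vectors at the points of the support lie below \<alpha>. Hence
  \<open>sf_mult\<close> sums over an infinite set at such an \<alpha> and returns 0.\<close>

lemma infinite_lower_set:
  assumes "infinite {u. \<alpha> u \<noteq> 0}"
  shows "infinite {\<beta> :: 'a \<Rightarrow> nat. \<forall>u. \<beta> u \<le> \<alpha> u}"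
proof
  assume fin: "finite {\<beta>. \<forall>u. \<beta> u \<le> \<alpha> u}"
  define e where "e u v = (if v = u then 1 else 0 :: nat)" for u v :: 'a
  have "e ` {u. \<alpha> u \<noteq> 0} \<subseteq> {\<beta>. \<forall>u. \<beta> u \<le> \<alpha> u}"
    by (auto simp: e_def)
  then have "finite (e ` {u. \<alpha> u \<noteq> 0})" using fin by (rule finite_subset)
  moreover have "inj_on e {u. \<alpha> u \<noteq> 0}"
    by (rule inj_onI) (metis e_def zero_neq_one)
  ultimately show False
    using assms finite_imageD by blast
qed

lemma h_part_infinite:
  assumes "infinite {u. \<alpha> u \<noteq> 0}"
  shows "h_part lam \<alpha> = 0"
proof (cases lam)
  case Nil
  then show ?thesis using assms by (auto simp: h_part_def sf_one_def)
next
  case (Cons p lam')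
  then show ?thesis using infinite_lower_set[OF assms] by (simp add: h_part_def sf_mult_def)
qed

lemma sf_coeff_hprod: "sf_coeff (mconst p * hprod (mset lam)) k = (\<lambda>\<alpha>. coeff p k * h_part lam \<alpha>)"
proof
  fix \<alpha>
  show "sf_coeff (mconst p * hprod (mset lam)) k \<alpha> = coeff p k * h_part lam \<alpha>"
    by (cases "finite {u. \<alpha> u \<noteq> 0}")
       (auto simp: sf_coeff_def h_part_count h_part_infinite count_Abs_multiset' mult.commute)
qed

lemma sf_coeff_add: "sf_coeff (F + G) k = (\<lambda>\<alpha>. sf_coeff F k \<alpha> + sf_coeff G k \<alpha>)"
  by (auto simp: sf_coeff_def mser_simps)

lemma sf_coeff_zero: "sf_coeff 0 k = (\<lambda>_. 0)"
  by (auto simp: sf_coeff_def mser_simps)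

section \<open>h-positivity, symmetry and unimodality of centered series\<close>

lemma h_positive_zero: "h_positive (\<lambda>_. 0)"
  unfolding h_positive_def by (intro exI[of _ "{}"] exI[of _ "\<lambda>_. 0"]) simp

lemma h_positive_add:
  assumes "h_positive f" "h_positive g"
  shows "h_positive (\<lambda>\<alpha>. f \<alpha> + g \<alpha>)"
proof -
  obtain S c where S: "finite S" "\<forall>lam\<in>S. is_partition lam" "\<forall>lam. 0 \<le> (c lam :: int)"
    "f = (\<lambda>\<alpha>. \<Sum>lam\<in>S. c lam * h_part lam \<alpha>)" using assms(1) unfolding h_positive_def by blast
  obtain R d where R: "finite R" "\<forall>lam\<in>R. is_partition lam" "\<forall>lam. 0 \<le> (d lam :: int)"
    "g = (\<lambda>\<alpha>. \<Sum>lam\<in>R. d lam * h_part lam \<alpha>)" using assms(2) unfolding h_positive_def by blast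
  define e where "e lam = (if lam \<in> S then c lam else 0) + (if lam \<in> R then d lam else 0)" for lam
  have "f \<alpha> + g \<alpha> = (\<Sum>lam\<in>S \<union> R. e lam * h_part lam \<alpha>)" for \<alpha>
  proof -
    have "f \<alpha> = (\<Sum>lam\<in>S \<union> R. (if lam \<in> S then c lam else 0) * h_part lam \<alpha>)"
      unfolding S(4) by (rule sum.mono_neutral_cong_left) (use S R in auto)
    moreover have "g \<alpha> = (\<Sum>lam\<in>S \<union> R. (if lam \<in> R then d lam else 0) * h_part lam \<alpha>)"
      unfolding R(4) by (rule sum.mono_neutral_cong_left) (use S R in auto)
    ultimately show ?thesis by (simp add: e_def distrib_right sum.distrib)
  qed
  then have "finite (S \<union> R) \<and> (\<forall>lam\<in>S \<union> R. is_partition lam) \<and> (\<forall>lam. 0 \<le> e lam)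
      \<and> (\<lambda>\<alpha>. f \<alpha> + g \<alpha>) = (\<lambda>\<alpha>. \<Sum>lam\<in>S \<union> R. e lam * h_part lam \<alpha>)"
    using S R by (auto simp: e_def)
  then show ?thesis unfolding h_positive_def by blast
qed

lemma h_positive_h_part:
  assumes "is_partition lam" "0 \<le> c"
  shows "h_positive (\<lambda>\<alpha>. c * h_part lam \<alpha>)"
  unfolding h_positive_def using assms
  by (intro exI[of _ "{lam}"] exI[of _ "\<lambda>_. c"]) simp

lemma ex_partition:
  assumes "0 \<notin># lam"
  shows "\<exists>xs. mset xs = lam \<and> is_partition xs"
proof (intro exI conjI)
  show "mset (rev (sorted_list_of_multiset lam)) = lam" by simp
  show "is_partition (rev (sorted_list_of_multiset lam))"
    using assms sorted_sorted_list_of_multiset[of lam]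
    by (auto simp: is_partition_def sorted_wrt_rev intro: ccontr)
qed

lemma coeff_interval: "coeff (tt ^ a * qint b) k = (if a \<le> k \<and> k < a + b then 1 else 0)"
proof -
  have "coeff (tt ^ a * qint b) k = (\<Sum>i<b. if i + a = k then 1 else 0)"
    unfolding qint_def sum_distrib_left coeff_sum
    by (intro sum.cong) (auto simp: tt_power mult_monom)
  also have "\<dots> = (\<Sum>i<b. if i = k - a then (if a \<le> k then 1 else 0) else 0)"
    by (intro sum.cong) auto
  also have "\<dots> = (if a \<le> k \<and> k < a + b then 1 else 0)"
    by (auto simp: sum.delta)
  finally show ?thesis .
qed

text \<open>All four properties are preserved by sums, so a single interval a, ..., N - a suffices.
  In the first half its coefficients can only rise from 0 to 1, since N - a is at least N/2.\<close>

lemma centered_coeffs: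
  assumes "centered N F"
  shows centered_h_positive: "h_positive (sf_coeff F k)"
    and centered_vanish: "N < k \<Longrightarrow> sf_coeff F k = (\<lambda>_. 0)"
    and centered_symmetric: "k \<le> N \<Longrightarrow> sf_coeff F k = sf_coeff F (N - k)"
    and centered_increasing: "2 * (k + 1) \<le> N \<Longrightarrow> h_le (sf_coeff F k) (sf_coeff F (k + 1))"
  using assms
proof (induction rule: centered.induct)
  case centered_zero
  {
    case 1 show ?case by (simp add: sf_coeff_zero h_positive_zero)
  next
    case 2 show ?case by (simp add: sf_coeff_zero)
  next
    case 3 show ?case by (simp add: sf_coeff_zero)
  next
    case 4 show ?case by (simp add: sf_coeff_zero h_le_def h_positive_zero)
  }
next
  case (centered_step a lam F)
  define p where "p = tt ^ a * qint (N + 1 - 2 * a)"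
  obtain xs where xs: "mset xs = lam" "is_partition xs" using ex_partition[OF centered_step(2)] by blast
  have p: "coeff p k = (if a \<le> k \<and> k \<le> N - a then 1 else 0)" for k
    using centered_step(1) by (auto simp: p_def coeff_interval)
  have c: "sf_coeff (mconst p * hprod lam + F) k = (\<lambda>\<alpha>. coeff p k * h_part xs \<alpha> + sf_coeff F k \<alpha>)" for k
    by (simp add: sf_coeff_add sf_coeff_hprod flip: xs(1))
  {
    case 1 show ?case
      unfolding p_def[symmetric] c
      using centered_step(4) by (intro h_positive_add h_positive_h_part[OF xs(2)]) (simp_all add: p)
  next
    case 2 then show ?case
      unfolding p_def[symmetric] c using centered_step by (auto simp: p)
  next
    case 3
    then have "a \<le> k \<and> k \<le> N - a \<longleftrightarrow> a \<le> N - k \<and> N - k \<le> N - a" using centered_step(1) by auto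
    then have "coeff p k = coeff p (N - k)" by (simp add: p)
    then show ?case unfolding p_def[symmetric] c using centered_step 3 by simp
  next
    case 4
    have "h_positive (\<lambda>\<alpha>. (coeff p (k + 1) - coeff p k) * h_part xs \<alpha>
        + (sf_coeff F (k + 1) \<alpha> - sf_coeff F k \<alpha>))"
      using 4 centered_step(1,7) by (intro h_positive_add h_positive_h_part[OF xs(2)]) (auto simp: p h_le_def)
    then show ?case unfolding p_def[symmetric] c h_le_def by (simp add: algebra_simps)
  }
qed

text \<open>The support may be smaller than 0, ..., N. Symmetry makes the last nonzero index N - r
  when the first one is r, so the actual center (r + s)/2 is still N/2.\<close>

lemma centered_t_symmetric_unimodal:
  assumes F: "centered N F" and nz: "sf_coeff F k \<noteq> (\<lambda>_. 0)"
  shows "t_symmetric (sf_coeff F) (real N / 2) \<and> t_unimodal (sf_coeff F)"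
proof -
  let ?a = "sf_coeff F"
  define r where "r = (LEAST k. ?a k \<noteq> (\<lambda>_. 0))"
  have r: "?a r \<noteq> (\<lambda>_. 0)" unfolding r_def using nz by (rule LeastI)
  have least: "?a k = (\<lambda>_. 0)" if "k < r" for k
    using not_less_Least[of k "\<lambda>k. ?a k \<noteq> (\<lambda>_. 0)"] that by (simp add: r_def)
  have "r \<le> N" using centered_vanish[OF F] r by (meson not_le)
  define s where "s = N - r"
  have s: "?a s \<noteq> (\<lambda>_. 0)" using centered_symmetric[OF F \<open>r \<le> N\<close>] r by (simp add: s_def)
  then have "r \<le> s" using least by (meson not_le)
  have N: "r + s = N" using \<open>r \<le> N\<close> by (simp add: s_def)
  have high: "?a k = (\<lambda>_. 0)" if "s < k" for k
  proof (cases "k \<le> N")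
    case True
    then show ?thesis using centered_symmetric[OF F True] least[of "N - k"] that N by simp
  qed (use centered_vanish[OF F] in simp)
  have bounds: "poly_bounds ?a r s"
    using \<open>r \<le> s\<close> r s least high by (auto simp: poly_bounds_def)
  have "?a (r + i) = ?a (s - i)" if "i \<le> s - r" for i
  proof -
    have "N - (r + i) = s - i" "r + i \<le> N" using N that \<open>r \<le> s\<close> by auto
    then show ?thesis using centered_symmetric[OF F] by metis
  qed
  then have "t_symmetric ?a (real N / 2)"
    unfolding t_symmetric_def using bounds N by (intro exI[of _ r] exI[of _ s]) auto
  moreover have up: "h_le (?a i) (?a (i + 1))" if "i < N div 2" for i
    using that by (intro centered_increasing[OF F]) presburger
  \<comment> \<open>The second half is the mirror image of the first under i \<mapsto> N -
    i.\<close>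
  moreover have down: "h_le (?a (i + 1)) (?a i)" if "(N + 1) div 2 \<le> i" "i < s" for i
  proof -
    have "h_le (?a (N - (i + 1))) (?a (N - (i + 1) + 1))"
      using that N by (intro centered_increasing[OF F]) presburger
    moreover have "N - (i + 1) + 1 = N - i" using that N by simp
    ultimately show ?thesis
      using centered_symmetric[OF F, of "i + 1"] centered_symmetric[OF F, of i] that N by simp
  qed
  moreover have "t_unimodal ?a"
    unfolding t_unimodal_def
  proof (intro exI conjI allI impI)
    show "poly_bounds ?a r s" by (rule bounds)
  qed (use up down N in blast)+
  ultimately show ?thesis by blast
qed

section \<open>Lyndon words\<close>

lemma le_append: "u \<le> u @ v" for u v :: "'a::linorder list"
  by (induction u) auto

lemma append_less_append_left [simp]: "u @ v < u @ w \<longleftrightarrow> v < w" for u v w :: "'a::linorder list"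
  by (induction u) auto

text \<open>By the length condition u is not a proper prefix of v, so the comparison is decided at a
  mismatch and appended words cannot change it.\<close>

lemma less_append_mono:
  fixes u v a b :: "'a::linorder list"
  assumes "u < v" "length v \<le> length u"
  shows "u @ a < v @ b"
  using assms by (induction u v rule: list_induct2') auto

lemma less_append_not_prefix:
  fixes u v a :: "'a::linorder list"
  assumes "u < v" "take (length u) v \<noteq> u"
  shows "u @ a < v"
  using assms by (induction u v rule: list_induct2') auto

text \<open>The suffix characterization suits factorizations; minimality among the rotations, which
  suits necklaces, is linked to it below.\<close>

definition lyndon :: "'a::linorder list \<Rightarrow> bool" where
  "lyndon w \<longleftrightarrow> w \<noteq> [] \<and> (\<forall>u v. w = u @ v \<longrightarrow> u \<noteq> [] \<longrightarrow> v \<noteq> [] \<longrightarrow> w < v)"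

lemma lyndonD: "lyndon (u @ v) \<Longrightarrow> u \<noteq> [] \<Longrightarrow> v \<noteq> [] \<Longrightarrow> u @ v < v"
  by (auto simp: lyndon_def)

lemma lyndon_nonempty: "lyndon w \<Longrightarrow> w \<noteq> []"
  by (simp add: lyndon_def)

lemma lyndon_singleton [simp]: "lyndon [x]"
  by (auto simp: lyndon_def Cons_eq_append_conv)

text \<open>First u @ v < v: otherwise u would be a prefix of v = u @ v', where v < v' decides. A
  proper suffix of u @ v is q @ v with q a proper suffix of u, or v, or a proper suffix of
  v.\<close>

lemma lyndon_append:
  fixes u v :: "'a::linorder list"
  assumes u: "lyndon u" and v: "lyndon v" and "u < v"
  shows "lyndon (u @ v)"
proof -
  have uv: "u @ v < v"
  proof (cases "take (length u) v = u")
    case True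
    then obtain v' where v': "v = u @ v'" by (metis append_take_drop_id)
    with \<open>u < v\<close> have "v' \<noteq> []" by auto
    with v v' lyndon_nonempty[OF u] have "v < v'" using lyndonD by blast
    then show ?thesis using v' by (metis append_less_append_left)
  qed (use \<open>u < v\<close> less_append_not_prefix in blast)
  have "u @ v < s" if eq: "u @ v = p @ s" and "p \<noteq> []" "s \<noteq> []" for p s
  proof -
    consider q where "u = p @ q" "s = q @ v" | q where "p = u @ q" "v = q @ s"
      using eq by (metis append_eq_append_conv2)
    then show ?thesis
    proof cases
      case 1
      show ?thesis
      proof (cases "q = []")
        case False
        then have "u < q" using 1 u \<open>p \<noteq> []\<close> lyndonD by blast
        then have "u @ v < q @ v" using 1 by (intro less_append_mono) auto
        then show ?thesis using 1 by simp
      qed (use 1 uv in simp)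
    next
      case 2
      show ?thesis
      proof (cases "q = []")
        case False
        then have "v < s" using 2 v \<open>s \<noteq> []\<close> lyndonD by blast
        with uv show ?thesis by simp
      qed (use 2 uv in simp)
    qed
  qed
  then show ?thesis using lyndon_nonempty[OF u] by (auto simp: lyndon_def)
qed

section \<open>Existence and uniqueness of the Lyndon factorization\<close>

definition lyndon_factors :: "'a::linorder list list \<Rightarrow> bool" where
  "lyndon_factors ls \<longleftrightarrow> (\<forall>w\<in>set ls. lyndon w) \<and> sorted_wrt (\<ge>) ls"

text \<open>Merge u with the first factor as long as that factor is larger; each merged word is
  again Lyndon.\<close>

lemma lyndon_factors_insert:
  fixes u :: "'a::linorder list"
  assumes "lyndon u" "lyndon_factors ls"
  shows "\<exists>ls'. lyndon_factors ls' \<and> concat ls' = u @ concat ls"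
  using assms
proof (induction ls arbitrary: u)
  case Nil
  then show ?case by (intro exI[of _ "[u]"]) (simp add: lyndon_factors_def)
next
  case (Cons v ls)
  show ?case
  proof (cases "u < v")
    case True
    have "lyndon v" "lyndon_factors ls" using Cons.prems by (auto simp: lyndon_factors_def)
    with Cons.IH[of "u @ v"] Cons.prems True lyndon_append show ?thesis by auto
  next
    case False
    then have "lyndon_factors (u # v # ls)"
      using Cons.prems by (auto simp: lyndon_factors_def)
    then show ?thesis by (intro exI[of _ "u # v # ls"]) simp
  qed
qed

lemma lyndon_factors_exist: "\<exists>ls. lyndon_factors ls \<and> concat ls = w" for w :: "'a::linorder list"
proof (induction w)
  case Nil
  then show ?case by (intro exI[of _ "[]"]) (simp add: lyndon_factors_def)
next
  case (Cons x w)
  then show ?case using lyndon_factors_insert[of "[x]"] by force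
qed

text \<open>The end of p falls inside a factor l or at its end. The piece s of l that p covers is a
  nonempty suffix of p, to which the Lyndon property can be applied.\<close>

lemma prefix_concat_split:
  assumes "p @ r = concat ls" "p \<noteq> []" "[] \<notin> set ls"
  shows "\<exists>as s l bs r'. ls = as @ l # bs \<and> p = concat as @ s \<and> s \<noteq> [] \<and> l = s @ r'"
  using assms
proof (induction ls arbitrary: p)
  case (Cons l ls)
  then have "p @ r = l @ concat ls" by simp
  then consider q where "l = p @ q" | q where "p = l @ q" "q @ r = concat ls" "q \<noteq> []"
    by (metis append_eq_append_conv2 append_Nil2)
  then show ?case
  proof cases
    case 1
    then show ?thesis using Cons.prems(2)
      by (intro exI[of _ "[]"] exI[of _ p] exI[of _ l] exI[of _ ls] exI[of _ q]) auto
  next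
    case 2
    obtain as s l' bs r' where "ls = as @ l' # bs \<and> q = concat as @ s \<and> s \<noteq> [] \<and> l' = s @ r'"
      using Cons.IH[OF 2(2,3)] Cons.prems(3) by auto
    then show ?thesis using 2 by (intro exI[of _ "l # as"]) auto
  qed
qed simp

text \<open>The first factor is the longest Lyndon prefix; hence the factorization is unique.\<close>

lemma lyndon_prefix_le_first_factor:
  fixes l p :: "'a::linorder list"
  assumes "lyndon_factors (l # ls)" "lyndon p" "p @ r = concat (l # ls)"
  shows "length p \<le> length l"
proof (rule ccontr)
  assume long: "\<not> length p \<le> length l"
  have ne: "[] \<notin> set (l # ls)" using assms(1) by (auto simp: lyndon_factors_def lyndon_def)
  then obtain as s l' bs r' where *: "l # ls = as @ l' # bs" "p = concat as @ s" "s \<noteq> []" "l' = s @ r'"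
    using prefix_concat_split[OF assms(3) lyndon_nonempty[OF assms(2)]] by blast
  have "as \<noteq> []" using * long by auto
  with *(1) obtain as' where as: "as = l # as'" by (cases as) auto
  then have "concat as \<noteq> []" using ne by auto
  \<comment> \<open>A Lyndon prefix longer than l would yield the cycle p < s \<le> l' \<le> l \<le>
    p.\<close>
  then have "p < s" using *(2,3) assms(2) lyndonD by blast
  also have "s \<le> l'" using *(4) le_append by blast
  also have "l' \<le> l" using assms(1) *(1) as by (auto simp: lyndon_factors_def)
  also have "l \<le> p" using *(2) as le_append by auto
  finally show False by simp
qed

lemma lyndon_factors_unique:
  fixes ls ms :: "'a::linorder list list"
  assumes "lyndon_factors ls" "lyndon_factors ms" "concat ls = concat ms"
  shows "ls = ms"
  using assms
proof (induction ls arbitrary: ms)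
  case Nil
  then show ?case by (cases ms) (auto simp: lyndon_factors_def lyndon_def)
next
  case (Cons l ls)
  have "l \<noteq> []" using Cons.prems(1) by (auto simp: lyndon_factors_def lyndon_def)
  then obtain m ms' where ms: "ms = m # ms'" using Cons.prems(3) by (cases ms) auto
  have "lyndon l" "lyndon m" using Cons.prems ms by (auto simp: lyndon_factors_def)
  then have "length l = length m"
    using lyndon_prefix_le_first_factor[OF Cons.prems(1), of m "concat ms'"]
      lyndon_prefix_le_first_factor[of m ms' l "concat ls"] Cons.prems ms
    by (simp add: order_antisym)
  then have "l = m \<and> concat ls = concat ms'" using Cons.prems(3) ms by simp
  then show ?case using Cons ms by (auto simp: lyndon_factors_def)
qed

section \<open>Lyndon words as representatives of primitive rotation classes\<close>

lemma lyndon_less_rotation: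
  fixes u v :: "'a::linorder list"
  assumes "lyndon (u @ v)" "u \<noteq> []" "v \<noteq> []"
  shows "u @ v < v @ u"
  using lyndonD[OF assms] le_append[of v u] by (rule less_le_trans)

lemma range_rotate: "range (\<lambda>i. rotate i w) = {v @ u |u v. w = u @ v}"
proof (intro set_eqI iffI)
  fix x assume "x \<in> range (\<lambda>i. rotate i w)"
  then obtain i where "x = rotate i w" by blast
  then have "x = drop (i mod length w) w @ take (i mod length w) w" by (simp add: rotate_drop_take)
  then show "x \<in> {v @ u |u v. w = u @ v}" by (metis (mono_tags, lifting) append_take_drop_id mem_Collect_eq)
next
  fix x assume "x \<in> {v @ u |u v. w = u @ v}"
  then obtain u v where "x = v @ u" "w = u @ v" by blast
  then have "x = rotate (length u) w" by (simp add: rotate_append)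
  then show "x \<in> range (\<lambda>i. rotate i w)" by blast
qed

lemma rotation_class_eq:
  assumes "x \<in> range (\<lambda>i. rotate i w)"
  shows "range (\<lambda>i. rotate i x) = range (\<lambda>i. rotate i w)"
proof -
  have sub: "range (\<lambda>i. rotate i x) \<subseteq> range (\<lambda>i. rotate i w)"
    if "x \<in> range (\<lambda>i. rotate i w)" for x w :: "'a list"
    using that by (auto simp: rotate_rotate)
  obtain u v where "w = u @ v" "x = v @ u" using assms by (auto simp: range_rotate)
  then have "w \<in> range (\<lambda>i. rotate i x)" by (auto simp: range_rotate)
  with sub assms show ?thesis by blast
qed

lemma lyndon_rotation_unique:
  fixes x w :: "'a::linorder list"
  assumes "lyndon x" "lyndon w" "x \<in> range (\<lambda>i. rotate i w)"
  shows "x = w"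
proof -
  obtain u v where uv: "w = u @ v" "x = v @ u" using assms(3) by (auto simp: range_rotate)
  show ?thesis
  proof (cases "u = [] \<or> v = []")
    case False
    then have "u @ v < v @ u" "v @ u < u @ v"
      using assms(1,2) lyndon_less_rotation[of u v] lyndon_less_rotation[of v u] unfolding uv by blast+
    then show ?thesis by simp
  qed (use uv in auto)
qed

text \<open>Rotating a proper power by its root returns the same word, whereas a Lyndon word is
  strictly below its nontrivial rotations.\<close>

lemma lyndon_primitive:
  fixes w :: "'a::linorder list"
  assumes "lyndon w"
  shows "primitive_word w"
proof -
  have False if "2 \<le> k" "w = concat (replicate k v)" for v k
  proof -
    obtain m where "k = Suc (Suc m)" using \<open>2 \<le> k\<close> by (metis Suc_le_D numeral_2_eq_2 Suc_le_mono)
    then have w: "w = v @ concat (replicate (Suc m) v)" using that by simp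
    have comm: "concat (replicate n v) @ v = v @ concat (replicate n v)" for n
      by (induction n) auto
    have "v \<noteq> []" using w lyndon_nonempty[OF assms] by auto
    with assms w lyndon_less_rotation[of v "concat (replicate (Suc m) v)"] comm[of "Suc m"]
    show False by auto
  qed
  then show ?thesis using lyndon_nonempty[OF assms] by (auto simp: primitive_word_def)
qed

lemma primitive_append_comm:
  assumes "primitive_word (u @ v)" "u @ v = v @ u"
  shows "u = [] \<or> v = []"
proof (rule ccontr)
  assume "\<not> (u = [] \<or> v = [])"
  moreover obtain m n zs where mn: "concat (replicate m zs) = u" "concat (replicate n zs) = v"
    using comm_append_are_replicate[OF assms(2)] by blast
  ultimately have "m \<noteq> 0" "n \<noteq> 0" by auto
  then have "2 \<le> m + n" by simp
  moreover have "u @ v = concat (replicate (m + n) zs)" using mn by (simp add: replicate_add)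
  ultimately show False using assms(1) unfolding primitive_word_def by blast
qed

text \<open>Suppose a proper suffix v of w = u @ v is smaller than w. If v is not a prefix of w,
  then the rotation v @ u is already smaller. If w = v @ v', then w < v @ u gives v' < u, and the
  rotation v' @ v is smaller than w.\<close>

lemma least_rotation_lyndon:
  fixes w :: "'a::linorder list"
  assumes prim: "primitive_word w" and least: "\<And>u v. w = u @ v \<Longrightarrow> w \<le> v @ u"
  shows "lyndon w"
proof -
  have "w < v" if w: "w = u @ v" and ne: "u \<noteq> []" "v \<noteq> []" for u v
  proof (rule ccontr)
    assume "\<not> w < v"
    moreover have "w \<noteq> v" using w ne by simp
    ultimately have "v < w" by simp
    have strict: "w < v @ u"
      using least[OF w] primitive_append_comm[of u v] prim w ne by (auto simp: order_le_less)
    show False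
    proof (cases "take (length v) w = v")
      case False
      then have "v @ u < w" using \<open>v < w\<close> less_append_not_prefix by blast
      then show False using strict by simp
    next
      case True
      then obtain v' where v': "w = v @ v'" by (metis append_take_drop_id)
      then have "v' < u" using strict by simp
      moreover have "length v' = length u" using v' w
        by (metis add_left_cancel length_append length_rotate rotate_append)
      ultimately have "v' @ v < u @ v" by (simp add: less_append_mono)
      then show False using least[OF v'] w by simp
    qed
  qed
  then show ?thesis using prim by (auto simp: lyndon_def primitive_word_def)
qed

text \<open>Moving one letter of a k-th power to the end gives the k-th power of the rotated root,
  so rotation preserves proper powers.\<close>

lemma primitive_rotation:
  assumes "primitive_word (u @ v)"
  shows "primitive_word (v @ u)"
proof -
  have False if k: "2 \<le> k" "v @ u = concat (replicate k z)" for k z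
  proof -
    have "u @ v = rotate (length v) (concat (replicate k z))" using k by (metis rotate_append)
    moreover have "\<exists>z'. rotate i (concat (replicate k z)) = concat (replicate k z')" for i
    proof (induction i)
      case (Suc i)
      then obtain z' where z': "rotate i (concat (replicate k z)) = concat (replicate k z')" by blast
      show ?case
      proof (cases z')
        case Nil
        then show ?thesis using z' by (intro exI[of _ "[]"]) simp
      next
        case (Cons a y)
        have "concat (replicate n (a # y)) @ [a] = a # concat (replicate n (y @ [a]))" for n
          by (induction n) auto
        moreover obtain k' where "k = Suc k'" using k(1) by (cases k) auto
        ultimately have "rotate1 (concat (replicate k z')) = concat (replicate k (y @ [a]))"
          using Cons by simp
        then show ?thesis using z' by auto
      qed
    qed auto
    ultimately obtain z' where "u @ v = concat (replicate k z')" by metis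
    then show False using assms k(1) unfolding primitive_word_def by blast
  qed
  then show ?thesis using assms by (auto simp: primitive_word_def)
qed

lemma ex_lyndon_rotation:
  fixes w :: "'a::linorder list"
  assumes "primitive_word w"
  shows "\<exists>x. lyndon x \<and> x \<in> range (\<lambda>i. rotate i w)"
proof -
  let ?R = "range (\<lambda>i. rotate i w)"
  have "?R = (\<lambda>i. rotate i w) ` {..<length w}"
    using assms by (auto simp: primitive_word_def image_iff)
       (metis length_greater_0_conv lessThan_iff mod_less_divisor rotate_conv_mod)
  then have "finite ?R" by simp
  define x where "x = Min ?R"
  have x: "x \<in> ?R" unfolding x_def using \<open>finite ?R\<close> by (intro Min_in) auto
  have "primitive_word x"
    using x assms primitive_rotation by (auto simp: range_rotate)
  moreover have "x \<le> v @ u" if "x = u @ v" for u v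
  proof -
    have "v @ u \<in> range (\<lambda>i. rotate i x)" using that by (auto simp: range_rotate)
    then have "v @ u \<in> ?R" using rotation_class_eq[OF x] by simp
    then show ?thesis unfolding x_def using \<open>finite ?R\<close> by simp
  qed
  ultimately show ?thesis using x least_rotation_lyndon by blast
qed

section \<open>Ornaments and banners\<close>

text \<open>The barred letter comes first within its absolute value so that a Lyndon word that is a
  necklace cannot end in it.\<close>

fun letter_key :: "letter \<Rightarrow> int \<times> nat" where
  "letter_key (Bar u) = (- int u, 0)"
| "letter_key (Let u m) = (- int u, Suc m)"

lemma letter_key_inject: "letter_key x = letter_key y \<Longrightarrow> x = y"
  by (cases x; cases y) auto

instantiation letter :: linorder
begin

definition less_eq_letter :: "letter \<Rightarrow> letter \<Rightarrow> bool" where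
  "less_eq_letter x y \<longleftrightarrow> letter_key x \<le> letter_key y"

definition less_letter :: "letter \<Rightarrow> letter \<Rightarrow> bool" where
  "less_letter x y \<longleftrightarrow> letter_key x < letter_key y"

instance
  by standard (auto simp: less_eq_letter_def less_letter_def letter_key_inject)

end

lemma letter_le_absv: "x \<le> y \<Longrightarrow> absv y \<le> absv x"
  by (cases x; cases y) (auto simp: less_eq_letter_def)

lemma letter_le_Bar: "x \<le> Bar u \<Longrightarrow> absv x \<le> u \<Longrightarrow> x = Bar u"
  by (cases x) (auto simp: less_eq_letter_def)

lemma list_le_hd: "x \<le> y \<Longrightarrow> x \<noteq> [] \<Longrightarrow> y \<noteq> [] \<Longrightarrow> hd x \<le> hd y" for x y :: "'a::linorder list"
  by (cases x; cases y) auto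

lemma lyndon_hd_le:
  fixes w :: "'a::linorder list"
  assumes "lyndon w" "x \<in> set w"
  shows "hd w \<le> x"
proof -
  obtain u v where w: "w = u @ x # v" using assms(2) by (meson split_list)
  show ?thesis
  proof (cases "u = []")
    case False
    then have "w < x # v" using assms(1) w lyndonD[of u "x # v"] by simp
    then show ?thesis using list_le_hd[of w "x # v"] w by simp
  qed (use w in simp)
qed

text \<open>Otherwise the one-letter word \<open>[last w]\<close> would be a proper suffix of w and
  also a prefix, hence not larger than w.\<close>

lemma lyndon_hd_eq_last:
  fixes w :: "'a::linorder list"
  assumes "lyndon w" "hd w = last w"
  shows "w = [last w]"
proof (rule ccontr)
  assume neq: "w \<noteq> [last w]"
  have w: "w = butlast w @ [last w]" using lyndon_nonempty[OF assms(1)] by simp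
  then have "butlast w \<noteq> []" using neq by auto
  then have "w < [last w]" using lyndonD[of "butlast w" "[last w]"] assms(1) w by simp
  then show False using assms(2) lyndon_nonempty[OF assms(1)] by (cases w) auto
qed

lemma banner_iff:
  "banner l w \<longleftrightarrow> (\<forall>x\<in>set w. valid_letter l x) \<and> successively follow_ok w
    \<and> (w \<noteq> [] \<longrightarrow> (\<forall>u. last w \<noteq> Bar u))"
  by (induction w) (auto simp: successively_Cons)

lemma banner_append_right: "banner l (u @ v) \<Longrightarrow> banner l v"
  by (induction u) auto

lemma successively_conv_nth:
  "successively P w \<longleftrightarrow> (\<forall>i. Suc i < length w \<longrightarrow> P (w ! i) (w ! Suc i))"
proof (induction w)
  case (Cons x w)
  show ?case
    unfolding successively_Cons Cons.IH
    by (cases w) (auto simp: nth_Cons split: nat.splits)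
qed simp

lemma necklace_word_iff:
  "necklace_word l w \<longleftrightarrow> primitive_word w \<and> (\<forall>x\<in>set w. valid_letter l x) \<and> successively follow_ok w
    \<and> follow_ok (last w) (hd w) \<and> (\<forall>u. w \<noteq> [Bar u])"
proof (cases "w = []")
  case False
  have "(\<forall>i<length w. follow_ok (w ! i) (w ! ((i + 1) mod length w))) \<longleftrightarrow>
      (\<forall>i. Suc i < length w \<longrightarrow> follow_ok (w ! i) (w ! Suc i)) \<and> follow_ok (last w) (hd w)" (is "?L \<longleftrightarrow> ?R")
  proof
    assume L: ?L
    have "follow_ok (w ! i) (w ! Suc i)" if "Suc i < length w" for i
      using L[rule_format, of i] that by simp
    moreover have "follow_ok (last w) (hd w)"
      using L[rule_format, of "length w - 1"] False by (simp add: last_conv_nth hd_conv_nth)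
    ultimately show ?R by blast
  next
    assume R: ?R
    show ?L
    proof (intro allI impI)
      fix i assume "i < length w"
      then consider "Suc i < length w" | "i = length w - 1" by linarith
      then show "follow_ok (w ! i) (w ! ((i + 1) mod length w))"
        using R False by cases (auto simp: last_conv_nth hd_conv_nth)
    qed
  qed
  then show ?thesis by (auto simp: necklace_word_def successively_conv_nth)
qed (simp add: necklace_word_def primitive_word_def)

lemma necklace_word_rotation:
  assumes "necklace_word l w" "x \<in> range (\<lambda>i. rotate i w)"
  shows "necklace_word l x"
proof -
  obtain u v where uv: "w = u @ v" "x = v @ u" using assms(2) by (auto simp: range_rotate)
  show ?thesis
  proof (cases "u = [] \<or> v = []")
    case True
    then show ?thesis using assms(1) uv by auto
  next
    case False
    then have "x \<noteq> [Bar u]" for u using uv by (auto simp: append_eq_Cons_conv)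
    then show ?thesis
      using assms(1) False primitive_rotation
      unfolding uv necklace_word_iff by (auto simp: successively_append_iff)
  qed
qed

text \<open>The cyclic condition gives the head absolute value at most u, and minimality puts it at
  or below \<open>Bar u\<close> in the letter order. So the head is \<open>Bar u\<close> as well,
  and w would be the forbidden word \<open>[Bar u]\<close>.\<close>

lemma lyndon_necklace_last:
  assumes "necklace_word l w" "lyndon w"
  shows "last w \<noteq> Bar u"
proof
  assume last: "last w = Bar u"
  have ne: "w \<noteq> []" using lyndon_nonempty[OF assms(2)] .
  then have "hd w \<le> Bar u" using lyndon_hd_le[OF assms(2) last_in_set] last by simp
  moreover have "absv (hd w) \<le> u"
    using assms(1) last by (auto simp: necklace_word_iff follow_ok_def)
  ultimately have "hd w = last w" using letter_le_Bar last by metis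
  then show False using lyndon_hd_eq_last[OF assms(2)] last assms(1) by (auto simp: necklace_word_iff)
qed

text \<open>Only the ends of factors matter. The head of a Lyndon word is its least letter and thus
  has the largest absolute value, and the heads weakly grow in absolute value along the factors; so
  a last letter of color 0 satisfies its condition both cyclically and at the seam. A barred last
  letter is impossible on either side.\<close>

lemma banner_concat_iff:
  assumes "lyndon_factors ls"
  shows "banner l (concat ls) \<longleftrightarrow> (\<forall>w\<in>set ls. necklace_word l w)"
  using assms
proof (induction ls)
  case (Cons w ls)
  have w: "lyndon w" "w \<noteq> []" and ls: "lyndon_factors ls"
    using Cons.prems by (auto simp: lyndon_factors_def lyndon_def)
  have hd_w: "absv (last w) \<le> absv (hd w)"
    using lyndon_hd_le[OF w(1), of "last w"] w(2) letter_le_absv by simp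
  have hd_ls: "hd (concat ls) \<le> hd w \<and> ls \<noteq> [] \<and> hd (concat ls) = hd (hd ls)" if ne: "concat ls \<noteq> []"
  proof -
    obtain v ls' where v: "ls = v # ls'" using ne by (cases ls) auto
    then have "v \<le> w" "v \<noteq> []" using Cons.prems by (auto simp: lyndon_factors_def lyndon_def)
    then show ?thesis using list_le_hd w(2) v by auto
  qed
  show ?case
  proof
    assume ban: "banner l (concat (w # ls))"
    then have "banner l (concat ls)" by (simp add: banner_append_right)
    with Cons.IH[OF ls] have nls: "\<forall>w\<in>set ls. necklace_word l w" by simp
    have "follow_ok (last w) (hd w) \<and> (\<forall>u. last w \<noteq> Bar u)"
    proof (cases "concat ls = []")
      case True
      then have "\<forall>u. last w \<noteq> Bar u" using ban w(2) by (simp add: banner_iff)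
      then show ?thesis using hd_w by (auto simp: follow_ok_def)
    next
      case False
      then have fol: "follow_ok (last w) (hd (concat ls))"
        using ban w(2) by (auto simp: banner_iff successively_append_iff)
      \<comment> \<open>A bar at the seam forces w = \<open>[Bar u]\<close> and then, as the factors
        do not increase, also the next factor to be \<open>[Bar u]\<close>. That factor is a
        necklace word by induction, a contradiction.\<close>
      have "last w \<noteq> Bar u" for u
      proof
        assume last: "last w = Bar u"
        have absv_le: "absv (hd (concat ls)) \<le> u" using fol last by (simp add: follow_ok_def)
        moreover have "absv (hd w) \<le> absv (hd (concat ls))"
          using hd_ls[OF False] letter_le_absv by blast
        moreover have "hd w \<le> Bar u" using lyndon_hd_le[OF w(1) last_in_set] w(2) last by simp
        ultimately have hdw: "hd w = Bar u" using letter_le_Bar by simp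
        then have "w = [Bar u]" using lyndon_hd_eq_last[OF w(1)] last by simp
        have "hd (concat ls) \<le> Bar u" using hd_ls[OF False] hdw by metis
        then have "hd (concat ls) = Bar u" using absv_le by (rule letter_le_Bar)
        then have hdls: "hd (hd ls) = Bar u" using hd_ls[OF False] by simp
        have ne: "ls \<noteq> []" using hd_ls[OF False] by simp
        then have "hd ls \<le> w" "hd ls \<noteq> []"
          using Cons.prems by (auto simp: lyndon_factors_def lyndon_def)
        then have "hd ls = [Bar u]" using hdls \<open>w = [Bar u]\<close> by (cases "hd ls") auto
        then show False using nls ne by (metis hd_in_set necklace_word_def)
      qed
      then show ?thesis using hd_w by (auto simp: follow_ok_def)
    qed
    then show "\<forall>w\<in>set (w # ls). necklace_word l w"
      using nls lyndon_primitive[OF w(1)] ban w(2)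
      by (auto simp: necklace_word_iff banner_iff successively_append_iff)
  next
    assume neck: "\<forall>w\<in>set (w # ls). necklace_word l w"
    then have ban: "banner l (concat ls)" using Cons.IH[OF ls] by simp
    have last: "last w \<noteq> Bar u" for u
      using neck by (intro lyndon_necklace_last[OF _ w(1), of l]) simp
    have "follow_ok (last w) (hd (concat ls))" if ne: "concat ls \<noteq> []"
    proof -
      have "follow_ok (last w) (hd w)" using neck by (simp add: necklace_word_iff)
      moreover have "absv (hd w) \<le> absv (hd (concat ls))"
        using hd_ls[OF ne] letter_le_absv by blast
      ultimately show ?thesis using last by (auto simp: follow_ok_def)
    qed
    moreover have "last (w @ concat ls) \<noteq> Bar u" for u
      using last ban by (cases "concat ls = []") (simp_all add: banner_iff last_append)
    ultimately show "banner l (concat (w # ls))"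
      using ban neck w(2) by (auto simp: banner_iff necklace_word_iff successively_append_iff)
  qed
qed simp

section \<open>The bijection between ornaments and banners\<close>

definition rotation_class :: "'a list \<Rightarrow> 'a list set" where
  "rotation_class w = range (\<lambda>i. rotate i w)"

definition lyndon_rep :: "'a::linorder list set \<Rightarrow> 'a list" where
  "lyndon_rep N = (THE x. lyndon x \<and> x \<in> N)"

lemma self_in_rotation_class: "w \<in> rotation_class w"
  unfolding rotation_class_def by (rule range_eqI[of _ _ 0]) simp

lemma lyndon_rep_rotation_class: "lyndon w \<Longrightarrow> lyndon_rep (rotation_class w) = w"
  unfolding lyndon_rep_def using self_in_rotation_class[of w] lyndon_rotation_unique
  by (intro the_equality) (auto simp: rotation_class_def)

lemma necklace_lyndon_rep:
  assumes "necklace l N"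
  shows "lyndon (lyndon_rep N)" "necklace_word l (lyndon_rep N)" "rotation_class (lyndon_rep N) = N"
proof -
  obtain w where w: "necklace_word l w" "N = rotation_class w"
    using assms by (auto simp: necklace_def rotation_class_def)
  then obtain x where x: "lyndon x" "x \<in> rotation_class w"
    using ex_lyndon_rotation[of w] by (auto simp: necklace_word_iff rotation_class_def)
  then have N: "N = rotation_class x"
    using w(2) rotation_class_eq[of x w] by (simp add: rotation_class_def)
  then have rep: "lyndon_rep N = x" using lyndon_rep_rotation_class x(1) by simp
  show "lyndon (lyndon_rep N)" "rotation_class (lyndon_rep N) = N"
    using rep x(1) N by auto
  show "necklace_word l (lyndon_rep N)"
    unfolding rep using necklace_word_rotation w(1) x(2) by (simp add: rotation_class_def)
qed

lemma mset_rotate: "mset (rotate i w) = mset w"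
  by (simp add: rotate_drop_take add.commute flip: mset_append)
     (metis append_take_drop_id mset_append union_commute)

text \<open>\<open>nword\<close> picks an arbitrary representative; rotations share their letters,
  so content and statistic do not depend on the choice.\<close>

lemma mset_nword: "mset (nword (rotation_class w)) = mset w"
proof -
  have "nword (rotation_class w) \<in> rotation_class w"
    unfolding nword_def using self_in_rotation_class by (rule someI)
  then show ?thesis by (auto simp: rotation_class_def mset_rotate)
qed

lemma orn_letters_rotation_classes: "orn_letters (mset (map rotation_class ls)) = mset (concat ls)"
  by (induction ls) (auto simp: orn_letters_def mset_nword)

definition ornaments :: "nat \<Rightarrow> nat multiset \<Rightarrow> ornament set" where
  "ornaments l M = {Or. (\<forall>N\<in>#Or. necklace l N) \<and> image_mset absv (orn_letters Or) = M}"

definition lyndon_factorization :: "'a::linorder list \<Rightarrow> 'a list list" where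
  "lyndon_factorization w = (THE ls. lyndon_factors ls \<and> concat ls = w)"

lemma lyndon_factorization:
  "lyndon_factors (lyndon_factorization w)" "concat (lyndon_factorization w) = w"
proof -
  have "\<exists>!ls. lyndon_factors ls \<and> concat ls = w"
    using lyndon_factors_exist[of w] lyndon_factors_unique by blast
  from theI'[OF this]
  show "lyndon_factors (lyndon_factorization w)" "concat (lyndon_factorization w) = w"
    unfolding lyndon_factorization_def by auto
qed

lemma lyndon_factorization_concat: "lyndon_factors ls \<Longrightarrow> lyndon_factorization (concat ls) = ls"
  using lyndon_factorization[of "concat ls"] lyndon_factors_unique by blast

lemma lyndon_factors_mset_eq:
  assumes "lyndon_factors ls" "lyndon_factors ms" "mset ls = mset ms"
  shows "ls = ms"
proof -
  have "sorted (rev ls)" "sorted (rev ms)"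
    using assms by (auto simp: lyndon_factors_def sorted_wrt_rev)
  moreover have "mset (rev ls) = mset (rev ms)" using assms by simp
  ultimately have "rev ls = rev ms" by (metis properties_for_sort)
  then show ?thesis by simp
qed

lemma bij_betw_banners_ornaments:
  "bij_betw (\<lambda>w. mset (map rotation_class (lyndon_factorization w))) (banners l M) (ornaments l M)"
  unfolding bij_betw_def
proof (intro conjI)
  let ?f = "\<lambda>w :: letter list. mset (map rotation_class (lyndon_factorization w))"
  have lyn: "x \<in># mset (lyndon_factorization w) \<Longrightarrow> lyndon x" for x w :: "letter list"
    using lyndon_factorization(1)[of w] by (auto simp: lyndon_factors_def)
  have rep: "image_mset lyndon_rep (?f w) = mset (lyndon_factorization w)" for w
  proof -
    have "map (\<lambda>x. lyndon_rep (rotation_class x)) (lyndon_factorization w) = lyndon_factorization w"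
      using lyn[of _ w] by (intro map_idI lyndon_rep_rotation_class) simp
    then show ?thesis by (simp add: o_def flip: mset_map)
  qed
  show "inj_on ?f (banners l M)"
  proof (rule inj_onI)
    fix w v assume "?f w = ?f v"
    then have "mset (lyndon_factorization w) = mset (lyndon_factorization v)" using rep by metis
    then have "lyndon_factorization w = lyndon_factorization v"
      using lyndon_factors_mset_eq lyndon_factorization(1) by blast
    then show "w = v" by (metis lyndon_factorization(2))
  qed
  show "?f ` banners l M = ornaments l M"
  proof (intro equalityI subsetI)
    fix Or assume "Or \<in> ?f ` banners l M"
    then obtain w where w: "banner l w" "mset (map absv w) = M" "Or = ?f w"
      by (auto simp: banners_def)
    then have "\<forall>x\<in>set (lyndon_factorization w). necklace_word l x"
      using banner_concat_iff[OF lyndon_factorization(1)] lyndon_factorization(2) by metis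
    then have "\<forall>N\<in>#Or. necklace l N" using w(3) by (auto simp: necklace_def rotation_class_def)
    moreover have "orn_letters Or = mset w"
      using w(3) orn_letters_rotation_classes lyndon_factorization(2) by metis
    ultimately show "Or \<in> ornaments l M" using w(2) by (simp add: ornaments_def)
  next
    fix Or assume Or: "Or \<in> ornaments l M"
    then have neck: "necklace l N" if "N \<in># Or" for N using that by (simp add: ornaments_def)
    \<comment> \<open>The inverse map: the Lyndon representatives, listed in nonincreasing order,
      are a Lyndon factorization.\<close>
    define ls where "ls = rev (sorted_list_of_multiset (image_mset lyndon_rep Or))"
    have mset_ls: "mset ls = image_mset lyndon_rep Or" by (simp add: ls_def)
    have set_ls: "set ls = lyndon_rep ` set_mset Or"
      using arg_cong[OF mset_ls, of set_mset] by simp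
    have "sorted_wrt (\<ge>) ls"
      using sorted_sorted_list_of_multiset by (simp add: ls_def sorted_wrt_rev)
    then have ls: "lyndon_factors ls"
      using neck necklace_lyndon_rep(1) by (auto simp: lyndon_factors_def set_ls)
    have "mset (map rotation_class ls) = image_mset (\<lambda>N. rotation_class (lyndon_rep N)) Or"
      by (simp add: mset_ls multiset.map_comp o_def)
    also have "\<dots> = image_mset (\<lambda>N. N) Or"
      using neck necklace_lyndon_rep(3) by (intro image_mset_cong) auto
    finally have Or_ls: "mset (map rotation_class ls) = Or" by simp
    have "banner l (concat ls)"
      using banner_concat_iff[OF ls] neck necklace_lyndon_rep(2) by (auto simp: set_ls)
    moreover have "mset (map absv (concat ls)) = M"
      using Or orn_letters_rotation_classes[of ls] unfolding Or_ls by (simp add: ornaments_def)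
    ultimately have "concat ls \<in> banners l M" by (simp add: banners_def)
    moreover have "?f (concat ls) = Or" using Or_ls lyndon_factorization_concat[OF ls] by simp
    ultimately show "Or \<in> ?f ` banners l M" by (metis imageI)
  qed
qed

lemma finite_ornaments [simp]: "finite (ornaments l M)"
  using bij_betw_finite[OF bij_betw_banners_ornaments] finite_banners by blast

lemma sum_ornaments:
  "(\<Sum>Or\<in>ornaments l M. tt ^ orn_stat l Or) = mcoeff (banner_series l (\<lambda>_. True)) M"
proof -
  have "orn_stat l (mset (map rotation_class (lyndon_factorization w))) = word_stat l w" for w
  proof -
    have "orn_letters (mset (map rotation_class (lyndon_factorization w))) = mset w"
      using orn_letters_rotation_classes lyndon_factorization(2) by metis
    then show ?thesis
      by (simp add: orn_stat_def word_stat_def sum_mset_sum_list flip: mset_map)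
  qed
  then show ?thesis
    by (simp add: banner_series.rep_eq flip: sum.reindex_bij_betw[OF bij_betw_banners_ornaments])
qed

subsection \<open>Single unbarred letters of color 0\<close>

definition single :: "nat \<Rightarrow> letter list set" where
  "single u = {[Let u 0]}"

definition is_single :: "letter list set \<Rightarrow> bool" where
  "is_single N \<longleftrightarrow> (\<exists>u. N = single u)"

lemma single_conv_rotation_class: "single u = rotation_class [Let u 0]"
proof -
  have "rotate i [x] = [x]" for i and x :: letter by (induction i) auto
  then show ?thesis by (auto simp: single_def rotation_class_def)
qed

lemma necklace_single:
  assumes "1 \<le> l"
  shows "necklace l (single u) \<longleftrightarrow> 1 \<le> u"
proof -
  have iff: "necklace_word l [Let u 0] \<longleftrightarrow> 1 \<le> u"
    using assms lyndon_primitive[OF lyndon_singleton] by (auto simp: necklace_word_iff follow_ok_def)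
  show ?thesis
  proof
    assume "necklace l (single u)"
    then obtain w where "necklace_word l w" "single u = rotation_class w"
      by (auto simp: necklace_def rotation_class_def)
    moreover then have "w = [Let u 0]" using self_in_rotation_class[of w] by (auto simp: single_def)
    ultimately show "1 \<le> u" using iff by simp
  next
    assume "1 \<le> u"
    then show "necklace l (single u)"
      using iff unfolding necklace_def single_conv_rotation_class rotation_class_def by blast
  qed
qed

lemma orn_letters_add: "orn_letters (Or + Or') = orn_letters Or + orn_letters Or'"
  by (simp add: orn_letters_def)

lemma orn_letters_singles: "orn_letters (image_mset single A) = image_mset (\<lambda>u. Let u 0) A"
  by (induction A) (auto simp: orn_letters_def single_conv_rotation_class mset_nword)

lemma orn_singles_conv: "orn_singles Or = size (filter_mset is_single Or)"
  by (simp add: orn_singles_def is_single_def[abs_def] single_def)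

lemma orn_singles_zero_iff: "orn_singles Or = 0 \<longleftrightarrow> (\<forall>N\<in>#Or. \<not> is_single N)"
  by (auto simp: orn_singles_conv filter_mset_eq_mempty_iff)

definition unsingle :: "letter list set \<Rightarrow> nat" where
  "unsingle N = (THE u. N = single u)"

lemma unsingle_single [simp]: "unsingle (single u) = u"
  by (auto simp: unsingle_def single_def)

lemma single_unsingle: "is_single N \<Longrightarrow> single (unsingle N) = N"
  by (auto simp: is_single_def)

text \<open>The series D. The necklaces \<open>u\<^sup>0\<close> play the part of fixed points, so
  these ornaments correspond to derangements.\<close>

lift_definition derangement_series :: "nat \<Rightarrow> int poly mser"
  is "\<lambda>l M. \<Sum>Or | Or \<in> ornaments l M \<and> orn_singles Or = 0. tt ^ orn_stat l Or" .

text \<open>The single necklaces form an arbitrary multiset A of positive integers; they multiply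
  the weight by the monomial of A and add 0 to the statistic. The weight g serves two uses: g = 1
  gives T = H D, and the indicator of j extracts \<open>Q\<close>.\<close>

lemma sum_ornaments_singles:
  assumes l: "1 \<le> l"
  shows "(\<Sum>Or\<in>ornaments l M. g (orn_singles Or) * tt ^ orn_stat l Or)
    = mcoeff (weighted_hseries g * derangement_series l) M"
proof -
  let ?O = "\<lambda>N. {Or. Or \<in> ornaments l N \<and> orn_singles Or = 0}"
  let ?S = "SIGMA A:{A. A \<subseteq># M \<and> 0 \<notin># A}. ?O (M - A)"
  let ?j = "\<lambda>(A, Or). image_mset single A + Or"
  let ?i = "\<lambda>Or. (image_mset unsingle (filter_mset is_single Or), filter_mset (\<lambda>N. \<not> is_single N) Or)"
  have split: "image_mset single (image_mset unsingle (filter_mset is_single Or))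
      + filter_mset (\<lambda>N. \<not> is_single N) Or = Or" for Or
  proof -
    have "image_mset single (image_mset unsingle (filter_mset is_single Or))
        = image_mset (\<lambda>N. N) (filter_mset is_single Or)"
      unfolding multiset.map_comp by (rule image_mset_cong) (auto simp: single_unsingle)
    then show ?thesis by (simp flip: multiset_partition)
  qed
  have filter: "filter_mset is_single (image_mset single A) = image_mset single A"
      "filter_mset (\<lambda>N. \<not> is_single N) (image_mset single A) = {#}" for A
    by (induction A) (auto simp: is_single_def)
  have filter': "filter_mset is_single Or = {#}" "filter_mset (\<lambda>N. \<not> is_single N) Or = Or"
    if "orn_singles Or = 0" for Or
    using that by (auto simp: orn_singles_zero_iff multiset_eq_iff simp flip: not_in_iff)
  have content: "image_mset absv (orn_letters (image_mset single A + Or)) = A + image_mset absv (orn_letters Or)"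
    for A Or by (simp add: orn_letters_add orn_letters_singles multiset.map_comp o_def)
  have stat: "orn_stat l (image_mset single A + Or) = orn_stat l Or" for A Or
    by (simp add: orn_stat_def orn_letters_add orn_letters_singles multiset.map_comp o_def letter_stat_def)
  have singles: "orn_singles (image_mset single A + Or) = size A + orn_singles Or" for A Or
    by (simp add: orn_singles_conv filter)
  have "(\<Sum>Or\<in>ornaments l M. g (orn_singles Or) * tt ^ orn_stat l Or)
      = (\<Sum>(A, Or)\<in>?S. g (size A) * tt ^ orn_stat l Or)"
  proof (rule sum.reindex_bij_witness[of _ ?j ?i])
    fix Or assume Or: "Or \<in> ornaments l M"
    define A where "A = image_mset unsingle (filter_mset is_single Or)"
    define Or' where "Or' = filter_mset (\<lambda>N. \<not> is_single N) Or"
    have Or_eq: "Or = image_mset single A + Or'" using split by (simp add: A_def Or'_def)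
    have "necklace l (single u)" if "u \<in># A" for u
      using that Or Or_eq by (auto simp: ornaments_def)
    then have "0 \<notin># A" using necklace_single[OF l, of 0] by auto
    moreover have "orn_singles Or' = 0" by (auto simp: orn_singles_zero_iff Or'_def)
    moreover have M: "M = A + image_mset absv (orn_letters Or')"
      using Or content[of A Or'] by (simp add: ornaments_def flip: Or_eq)
    moreover have "\<forall>N\<in>#Or'. necklace l N" using Or by (auto simp: ornaments_def Or'_def)
    ultimately show "?i Or \<in> ?S" by (simp add: ornaments_def flip: A_def Or'_def)
    show "?j (?i Or) = Or" using split by simp
    show "(case ?i Or of (A, Or) \<Rightarrow> g (size A) * tt ^ orn_stat l Or)
        = g (orn_singles Or) * tt ^ orn_stat l Or"
      using \<open>orn_singles Or' = 0\<close> singles[of A Or'] stat[of A Or']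
      by (simp flip: A_def Or'_def Or_eq)
  next
    fix p assume p: "p \<in> ?S"
    then obtain A Or where A: "p = (A, Or)" "A \<subseteq># M" "0 \<notin># A" "Or \<in> ornaments l (M - A)" "orn_singles Or = 0"
      by auto
    have "necklace l (single u)" if "u \<in># A" for u
    proof -
      have "u \<noteq> 0" using that A(3) by metis
      then show ?thesis using necklace_single[OF l] by simp
    qed
    then show "?j p \<in> ornaments l M"
      using A content[of A Or] by (auto simp: ornaments_def)
    show "?i (?j p) = p"
      using A filter' by (simp add: filter multiset.map_comp o_def)
  qed
  also have "\<dots> = (\<Sum>A | A \<subseteq># M \<and> 0 \<notin># A. g (size A) * mcoeff (derangement_series l) (M - A))"
    by (subst sum.Sigma[symmetric]) (auto simp: derangement_series.rep_eq sum_distrib_left)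
  also have "\<dots> = mcoeff (weighted_hseries g * derangement_series l) M"
    unfolding times_mser.rep_eq weighted_hseries.rep_eq
    by (rule sum.mono_neutral_cong_left) auto
  finally show ?thesis .
qed

lemma banner_series_eq_mult:
  assumes "1 \<le> l"
  shows "banner_series l (\<lambda>_. True) = hseries 1 {1..} * derangement_series l"
proof (rule mser_eqI)
  fix M
  show "mcoeff (banner_series l (\<lambda>_. True)) M = mcoeff (hseries 1 {1..} * derangement_series l) M"
    unfolding hseries_one_conv using sum_ornaments_singles[OF assms, of "\<lambda>_. 1" M]
    by (simp add: sum_ornaments)
qed

section \<open>The functions Q as coefficients of the series\<close>

lemma Q_conv_sf_coeff:
  assumes l: "1 \<le> l"
  shows "Q l n k j = sf_coeff (mgrade n (hcomp j * derangement_series l)) k"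
proof
  fix \<alpha>
  show "Q l n k j \<alpha> = sf_coeff (mgrade n (hcomp j * derangement_series l)) k \<alpha>"
  proof (cases "finite {u. \<alpha> u \<noteq> 0}")
    case False
    have "orn_content Or \<noteq> \<alpha>" for Or
      using False finite_count[of "image_mset absv (orn_letters Or)"] by (auto simp: orn_content_def[abs_def])
    then show ?thesis using False by (simp add: Q_def sf_coeff_def)
  next
    case True
    define M where "M = Abs_multiset \<alpha>"
    have \<alpha>: "\<alpha> = count M" using count_Abs_multiset'[OF True] by (simp add: M_def)
    have content: "orn_content Or = \<alpha> \<longleftrightarrow> image_mset absv (orn_letters Or) = M" for Or
      unfolding \<alpha> by (auto simp: orn_content_def[abs_def] multiset_eq_iff fun_eq_iff)
    have "Q l n k j \<alpha> = int (card {Or \<in> ornaments l M. size M = n \<and> orn_stat l Or = k \<and> orn_singles Or = j})"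
      unfolding Q_def content by (intro arg_cong[of _ _ int] arg_cong[of _ _ card])
        (auto simp: ornaments_def)
    also have "\<dots> = (if size M = n then
        (\<Sum>Or\<in>ornaments l M. if orn_singles Or = j \<and> orn_stat l Or = k then 1 else 0) else 0)"
      by (auto simp: sum.If_cases Int_def conj_commute)
    also have "\<dots> = (if size M = n then coeff
        (\<Sum>Or\<in>ornaments l M. (if orn_singles Or = j then 1 else 0) * tt ^ orn_stat l Or) k else 0)"
      by (auto simp: coeff_sum tt_power intro!: sum.cong)
    also have "\<dots> = sf_coeff (mgrade n (hcomp j * derangement_series l)) k \<alpha>"
      using True sum_ornaments_singles[OF l, of "\<lambda>m. if m = j then 1 else 0" M]
      by (simp add: sf_coeff_def mgrade.rep_eq hcomp_def flip: M_def)
    finally show ?thesis .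
  qed
qed

lemma mgrade_hcomp_mult: "mgrade n (hcomp j * F) = (if j \<le> n then hcomp j * mgrade (n - j) F else 0)"
proof -
  have "mgrade m (hcomp j) = (if m = j then hcomp j else 0)" for m
    by (rule mser_eqI) (auto simp: hcomp_def mgrade.rep_eq weighted_hseries.rep_eq mser_simps)
  then have "mgrade n (hcomp j * F) = (\<Sum>m\<le>n. if m = j then hcomp j * mgrade (n - j) F else 0)"
    unfolding mgrade_mult
    by (intro sum.cong) auto
  then show ?thesis by (simp add: sum.delta)
qed

lemma sf_coeff_sum: "sf_coeff (sum f A) k \<alpha> = (\<Sum>x\<in>A. sf_coeff (f x) k \<alpha>)"
  by (induction A rule: infinite_finite_induct) (auto simp: sf_coeff_zero sf_coeff_add)

lemma Qsum_conv_sf_coeff: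
  assumes l: "1 \<le> l"
  shows "Qsum l n k = sf_coeff (mgrade n (banner_series l (\<lambda>_. True))) k"
proof
  fix \<alpha>
  have "mgrade n (banner_series l (\<lambda>_. True)) = (\<Sum>j\<le>n. hcomp j * mgrade (n - j) (derangement_series l))"
    unfolding banner_series_eq_mult[OF l] hseries_one_conv mgrade_mult
    by (simp add: mgrade_weighted_hseries mconst_1)
  also have "\<dots> = (\<Sum>j\<le>n. mgrade n (hcomp j * derangement_series l))"
    by (intro sum.cong) (auto simp: mgrade_hcomp_mult)
  finally show "Qsum l n k \<alpha> = sf_coeff (mgrade n (banner_series l (\<lambda>_. True))) k \<alpha>"
    by (simp add: Qsum_def Q_conv_sf_coeff[OF l] sf_coeff_sum)
qed

theorem theorem4p9:
  fixes l :: nat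
  assumes "1 \<le> l"
  shows "(\<forall>n k j. h_positive (Q l n k j))
    \<and> (\<forall>n j. 1 \<le> n \<longrightarrow> j \<le> n \<longrightarrow>
          (let a = (\<lambda>k. if k \<le> l * n - 1 then Q l n k j else (\<lambda>_. 0)) in
           (\<exists>k. a k \<noteq> (\<lambda>_. 0)) \<longrightarrow>
             t_symmetric a (real l * (real n - real j) / 2) \<and> t_unimodal a))
    \<and> (\<forall>n. 1 \<le> n \<longrightarrow>
          (let a = (\<lambda>k. if k \<le> l * n - 1 then Qsum l n k else (\<lambda>_. 0)) in
             t_symmetric a ((real l * real n - 1) / 2) \<and> t_unimodal a))"
proof -
  let ?D = "derangement_series l" and ?T = "banner_series l (\<lambda>_. True)"
  note rec = derangement_series_recursions[OF assms banner_series_eq_mult[OF assms]]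
  have Qc: "Q l n k j = sf_coeff (hcomp j * mgrade (n - j) ?D) k" if "j \<le> n" for n k j
    using that by (simp add: Q_conv_sf_coeff[OF assms] mgrade_hcomp_mult)
  have Q0: "Q l n k j = (\<lambda>_. 0)" if "n < j" for n k j
    using that by (simp add: Q_conv_sf_coeff[OF assms] mgrade_hcomp_mult sf_coeff_zero)
  have cen: "centered (l * (n - j)) (hcomp j * mgrade (n - j) ?D)" for n j
    using centered_mult[OF centered_hcomp[of 0 0 j] centered_derangement_component[OF assms rec(1), of "n - j"]]
    by (simp add: qint_def mconst_1)
  have cenT: "centered (l * n - 1) (mgrade n ?T)" if "1 \<le> n" for n
    using centered_total_component[OF assms that rec] .
  have Q_nonneg: "0 \<le> Q l n k j \<alpha>" for n k j \<alpha> by (simp add: Q_def)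
  have Qsum_vanish: "Qsum l n k = (\<lambda>_. 0)" if "1 \<le> n" "l * n - 1 < k" for n k
    using centered_vanish[OF cenT] that by (simp add: Qsum_conv_sf_coeff[OF assms])
  \<comment> \<open>Centering bounds k by l(n - j) only, which for j = 0 admits k = ln. That index
    is excluded because the sum over j vanishes there and its terms are nonnegative.\<close>
  have Q_vanish: "Q l n k j = (\<lambda>_. 0)" if "1 \<le> n" "l * n - 1 < k" "j \<le> n" for n k j
  proof
    fix \<alpha>
    have "(\<Sum>j\<le>n. Q l n k j \<alpha>) = 0" using Qsum_vanish[OF that(1,2)] by (metis Qsum_def)
    then show "Q l n k j \<alpha> = 0" using that(3) Q_nonneg by (simp add: sum_nonneg_eq_0_iff)
  qed
  have part1: "h_positive (Q l n k j)" for n k j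
    using centered_h_positive[OF cen] Qc Q0 h_positive_zero by (cases "j \<le> n") auto
  \<comment> \<open>A nonzero coefficient is assumed because the zero polynomial has no center; it
    occurs for l = 1 and j = n - 1, since the degree 1 part of D is then 0.\<close>
  have part2: "t_symmetric a (real l * (real n - real j) / 2) \<and> t_unimodal a"
    if "1 \<le> n" "j \<le> n" "a = (\<lambda>k. if k \<le> l * n - 1 then Q l n k j else (\<lambda>_. 0))" "a k \<noteq> (\<lambda>_. 0)"
    for n j a k
  proof -
    have a: "a = sf_coeff (hcomp j * mgrade (n - j) ?D)"
      using that Qc Q_vanish by (auto simp: fun_eq_iff not_le)
    have "real l * (real n - real j) = real (l * (n - j))" using that(2) by (simp add: of_nat_diff)
    then show ?thesis
      using centered_t_symmetric_unimodal[OF cen] that(4) unfolding a by metis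
  qed
  have part3: "t_symmetric a ((real l * real n - 1) / 2) \<and> t_unimodal a"
    if "1 \<le> n" "a = (\<lambda>k. if k \<le> l * n - 1 then Qsum l n k else (\<lambda>_. 0))" for n a
  proof -
    have a: "a = sf_coeff (mgrade n ?T)"
      using that Qsum_vanish by (auto simp: fun_eq_iff not_le simp flip: Qsum_conv_sf_coeff[OF assms])
    have "1 \<le> l * n" using assms that(1) by (cases "l * n") auto
    then have center: "real l * real n - 1 = real (l * n - 1)" by (simp add: of_nat_diff)
    \<comment> \<open>The monomial consisting of the n-th power of x_1 has coefficient 1 in
      Q_{n,0,n} = \<open>h\<^sub>n\<close>, which shows that the full polynomial is nonzero.\<close>
    let ?\<alpha> = "count (replicate_mset n 1)"
    have "Q l n 0 n = sf_coeff (hcomp n) 0" using Qc[of n n 0] mgrade_0_recursion[OF rec(1)] by simp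
    then have "Q l n 0 n ?\<alpha> = 1"
      using finite_count[of "replicate_mset n 1"]
      by (simp add: sf_coeff_def count_inverse hcomp_def weighted_hseries.rep_eq)
    moreover have "Q l n 0 n ?\<alpha> \<le> Qsum l n 0 ?\<alpha>"
      unfolding Qsum_def using Q_nonneg by (intro member_le_sum) auto
    ultimately have "Qsum l n 0 ?\<alpha> \<noteq> 0" by linarith
    then have "Qsum l n 0 \<noteq> (\<lambda>_. 0)" by metis
    then show ?thesis
      using centered_t_symmetric_unimodal[OF cenT[OF that(1)]]
      unfolding a center Qsum_conv_sf_coeff[OF assms] by metis
  qed
  show ?thesis
    unfolding Let_def using part1 part2 part3 by blast
qed

end
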